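(* Let $\lambda>0$. As $t\to\infty$: (i) $\operatorname{Var}(u(\alpha t+\sigma\sqrt{\lambda t\log t},t))\to 0$ if $\lambda\ge 1/2$. (ii) $\operatorname{Var}(u(\alpha t+\sigma\sqrt{\lambda t\log t},t))\to\infty$ if $\lambda<1/2$. (iii) For $0<\delta<\infty$, $\operatorname{Var}\left(u\left(\alpha t+\sigma\sqrt{t\left(\tfrac12\log t-\tfrac32\log\log t-\log\delta\right)},\,t\right)\right)\sim\delta$.
   Context: Fix $\alpha\in(0,1)$ and let $\sigma=\sqrt{\alpha(1-\alpha)}$. Let $W$ be a standard one-dimensional Brownian motion on $[0,\infty)$. The continuous one-dimensional Conga line is, for $x>0$, $t>0$, $$u(x,t)=\int_0^t\overline{\Phi}\left(\frac{x-\alpha z}{\sigma\sqrt z}\right)dW^t_z,\qquad W^t_z=W(t)-W(t-z),\ 0\le z\le t,$$ where $\overline\Phi=1-\Phi$ and $\Phi$ is the standard normal distribution function. For positive functions $f,g$ of $t$ (possibly constant), $f(t)\sim g(t)$ means that there is a constant $C<\infty$ such that $\frac{f(t)}{g(t)}\vee\frac{g(t)}{f(t)}\le C$ for all sufficiently large $t$. *)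

theory Defs
  imports "HOL-Probability.Probability"
begin

locale brownian_motion = prob_space M for M :: "'a measure" +
  fixes W :: "real \<Rightarrow> 'a \<Rightarrow> real"
  assumes W_measurable: "\<And>t. 0 \<le> t \<Longrightarrow> W t \<in> borel_measurable M"
    and W_start: "AE \<omega> in M. W 0 \<omega> = 0"
    and W_normal: "\<And>s t. 0 \<le> s \<Longrightarrow> s < t \<Longrightarrow>
      distributed M lborel (\<lambda>\<omega>. W t \<omega> - W s \<omega>) (normal_density 0 (sqrt (t - s)))"
    and W_indep: "\<And>(n :: nat) (p :: nat \<Rightarrow> real). 0 \<le> p 0 \<Longrightarrow> (\<forall>i<n. p i < p (Suc i)) \<Longrightarrow>
      indep_vars (\<lambda>_. borel) (\<lambda>i \<omega>. W (p (Suc i)) \<omega> - W (p i) \<omega>) {..<n}"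
    and W_continuous: "AE \<omega> in M. continuous_on {0..} (\<lambda>t. W t \<omega>)"

definition partition_of :: "real \<Rightarrow> real \<Rightarrow> nat \<Rightarrow> (nat \<Rightarrow> real) \<Rightarrow> bool" where
  "partition_of a b n p \<longleftrightarrow> p 0 = a \<and> p n = b \<and> (\<forall>i<n. p i \<le> p (Suc i))"

definition step_fun :: "nat \<Rightarrow> (nat \<Rightarrow> real) \<Rightarrow> (nat \<Rightarrow> real) \<Rightarrow> real \<Rightarrow> real" where
  "step_fun n p c z = (\<Sum>i<n. c i * indicator {p i<..p (Suc i)} z)"

definition step_integral ::
    "(real \<Rightarrow> 'a \<Rightarrow> real) \<Rightarrow> nat \<Rightarrow> (nat \<Rightarrow> real) \<Rightarrow> (nat \<Rightarrow> real) \<Rightarrow> 'a \<Rightarrow> real" where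
  "step_integral X n p c \<omega> = (\<Sum>i<n. c i * (X (p (Suc i)) \<omega> - X (p i) \<omega>))"

text \<open>The stochastic integral of a deterministic integrand \<open>f\<close> over \<open>[a, b]\<close> (Wiener integral):
  the limit in \<open>L\<^sup>2(M)\<close> of the elementary integrals of step functions that converge to \<open>f\<close>
  in \<open>L\<^sup>2([a, b])\<close>. For a Brownian integrator the limit does not depend, up to almost sure
  equality, on the approximating sequence.\<close>

definition has_wiener_integral ::
    "'a measure \<Rightarrow> (real \<Rightarrow> 'a \<Rightarrow> real) \<Rightarrow> (real \<Rightarrow> real) \<Rightarrow> real \<Rightarrow> real \<Rightarrow> ('a \<Rightarrow> real) \<Rightarrow> bool" where
  "has_wiener_integral M X f a b J \<longleftrightarrow>
     set_borel_measurable lborel {a..b} f \<and>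
     J \<in> borel_measurable M \<and> integrable M (\<lambda>\<omega>. (J \<omega>)\<^sup>2) \<and>
     (\<exists>(n :: nat \<Rightarrow> nat) (p :: nat \<Rightarrow> nat \<Rightarrow> real) (c :: nat \<Rightarrow> nat \<Rightarrow> real).
        (\<forall>k. partition_of a b (n k) (p k)) \<and>
        (\<lambda>k. \<integral>\<^sup>+z\<in>{a..b}. ennreal ((step_fun (n k) (p k) (c k) z - f z)\<^sup>2) \<partial>lborel)
          \<longlonglongrightarrow> 0 \<and>
        (\<lambda>k. \<integral>\<^sup>+\<omega>. ennreal ((step_integral X (n k) (p k) (c k) \<omega> - J \<omega>)\<^sup>2) \<partial>M)
          \<longlonglongrightarrow> 0)"

text \<open>Some fixed version of the integral.\<close>

definition wiener_integral ::
    "'a measure \<Rightarrow> (real \<Rightarrow> 'a \<Rightarrow> real) \<Rightarrow> (real \<Rightarrow> real) \<Rightarrow> real \<Rightarrow> real \<Rightarrow> 'a \<Rightarrow> real" where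
  "wiener_integral M X f a b = (SOME J. has_wiener_integral M X f a b J)"

definition Phi :: "real \<Rightarrow> real" where
  "Phi x = cdf std_normal_distribution x"

definition Phi_bar :: "real \<Rightarrow> real" where
  "Phi_bar x = 1 - Phi x"

definition conga_sigma :: "real \<Rightarrow> real" where
  "conga_sigma \<alpha> = sqrt (\<alpha> * (1 - \<alpha>))"

definition reversed :: "(real \<Rightarrow> 'a \<Rightarrow> real) \<Rightarrow> real \<Rightarrow> real \<Rightarrow> 'a \<Rightarrow> real" where
  "reversed W t z \<omega> = W t \<omega> - W (t - z) \<omega>"

text \<open>Meaningful for \<open>x > 0\<close> and \<open>t > 0\<close>. At \<open>z = 0\<close> the integrand involves a division by zero,
  which does not matter since the integral depends on the integrand only up to null sets.\<close>

definition conga ::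
    "'a measure \<Rightarrow> (real \<Rightarrow> 'a \<Rightarrow> real) \<Rightarrow> real \<Rightarrow> real \<Rightarrow> real \<Rightarrow> 'a \<Rightarrow> real" where
  "conga M W \<alpha> x t =
     wiener_integral M (reversed W t)
       (\<lambda>z. Phi_bar ((x - \<alpha> * z) / (conga_sigma \<alpha> * sqrt z))) 0 t"

text \<open>Agreement up to a constant factor. Positivity is part of the definition because
  \<open>y / 0 = 0\<close> would otherwise let functions with zeros satisfy the bound.\<close>

definition same_order :: "(real \<Rightarrow> real) \<Rightarrow> (real \<Rightarrow> real) \<Rightarrow> bool" where
  "same_order f g \<longleftrightarrow>
     (\<exists>C. \<forall>\<^sub>F t in at_top. 0 < f t \<and> 0 < g t \<and> max (f t / g t) (g t / f t) \<le> C)"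

end

theory Submission
  imports Defs "HOL-Real_Asymp.Real_Asymp"
begin

text \<open>
The conga line is a Wiener integral of a deterministic integrand, so its variance at \<open>(x, t)\<close> is
the Lebesgue integral of \<open>(Phi_bar ((x - \<alpha> z) / (\<sigma> sqrt z))) ^ 2\<close> over \<open>{0..t}\<close>
(\<open>variance_conga\<close>). Two facts about the integral are behind this formula. The isometry holds for
every version of the integral (\<open>has_wiener_integral_second_moment\<close>), so the arbitrary choice of a
version is harmless; and a version exists because the integrand is monotone in \<open>z\<close>
(\<open>has_wiener_integral_mono_on_exists\<close>): for a monotone integrand the dyadic step functions converge at
a geometric rate in mean square, on the time axis as well as on the probability space.

The rest is the asymptotics of that integral for \<open>x = \<alpha> t + \<sigma> sqrt t L\<close> with \<open>L\<close> large, but at most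
\<open>sqrt t\<close>. At
\<open>z = t - s\<close> the argument of \<open>Phi_bar\<close> is, to leading order, \<open>L + (\<alpha> / \<sigma>) s / sqrt t\<close>, and
\<open>(Phi_bar (L + v)) ^ 2\<close> is of order \<open>exp (- L ^ 2 - 2 L v) / L ^ 2\<close>. Hence only a window of width of
order \<open>sqrt t / L\<close> next to \<open>z = t\<close> matters, and the variance is of the exact order
\<open>profile t L = sqrt t * exp (- L ^ 2) / L ^ 3\<close>; the two inequalities are
\<open>integral_Phi_bar_square_le\<close> and \<open>integral_Phi_bar_square_ge\<close>.

For \<open>L ^ 2 = lam * ln t\<close> the profile is \<open>t powr (1/2 - lam)\<close> divided by \<open>(lam * ln t) powr (3/2)\<close>. The
exponent changes sign at \<open>lam = 1/2\<close>, where the logarithm alone still forces the limit \<open>0\<close>. For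
\<open>L ^ 2 = 1/2 * ln t - 3/2 * ln (ln t) - ln \<delta>\<close> the exponential cancels \<open>sqrt t\<close> and leaves
\<open>\<delta> * (ln t) powr (3/2) / L ^ 3\<close>, which tends to \<open>\<delta> * 2 powr (3/2)\<close> because \<open>L ^ 2\<close> is asymptotic to
\<open>1/2 * ln t\<close>.
\<close>

section \<open>Mean-square convergence\<close>

lemma integrable_mult_of_square_integrable:
  fixes f g :: "'a \<Rightarrow> real"
  assumes [measurable]: "f \<in> borel_measurable M" "g \<in> borel_measurable M"
    and f: "integrable M (\<lambda>x. (f x)\<^sup>2)" and g: "integrable M (\<lambda>x. (g x)\<^sup>2)"
  shows "integrable M (\<lambda>x. f x * g x)"
proof (rule Bochner_Integration.integrable_bound)
  show "integrable M (\<lambda>x. (f x)\<^sup>2 + (g x)\<^sup>2)"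
    using f g by simp
  have "\<bar>f x * g x\<bar> \<le> (f x)\<^sup>2 + (g x)\<^sup>2" for x
  proof -
    have "0 \<le> (f x + g x)\<^sup>2" "0 \<le> (f x - g x)\<^sup>2" "0 \<le> (f x)\<^sup>2" "0 \<le> (g x)\<^sup>2"
      by simp_all
    then show ?thesis
      unfolding power2_sum power2_diff abs_le_iff mult.assoc by linarith
  qed
  then show "AE x in M. norm (f x * g x) \<le> norm ((f x)\<^sup>2 + (g x)\<^sup>2)"
    by (simp add: abs_of_nonneg)
qed simp

lemma integrable_square_diff:
  fixes f g :: "'a \<Rightarrow> real"
  assumes "f \<in> borel_measurable M" "g \<in> borel_measurable M"
    and "integrable M (\<lambda>x. (f x)\<^sup>2)" "integrable M (\<lambda>x. (g x)\<^sup>2)"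
  shows "integrable M (\<lambda>x. (f x - g x)\<^sup>2)"
proof -
  have "integrable M (\<lambda>x. 2 * (f x * g x))"
    by (rule integrable_mult_right[OF integrable_mult_of_square_integrable[OF assms]])
  then have "integrable M (\<lambda>x. (f x)\<^sup>2 + (g x)\<^sup>2 - 2 * (f x * g x))"
    by (rule Bochner_Integration.integrable_diff[OF Bochner_Integration.integrable_add[OF assms(3,4)]])
  then show ?thesis
    by (simp only: power2_diff mult.assoc)
qed

lemma L2_tendsto_real:
  fixes F :: "nat \<Rightarrow> 'a \<Rightarrow> real"
  assumes F: "\<And>k. F k \<in> borel_measurable M" and f: "f \<in> borel_measurable M"
    and Fint: "\<And>k. integrable M (\<lambda>x. (F k x)\<^sup>2)" and fint: "integrable M (\<lambda>x. (f x)\<^sup>2)"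
    and lim: "(\<lambda>k. \<integral>\<^sup>+x. ennreal ((F k x - f x)\<^sup>2) \<partial>M) \<longlonglongrightarrow> 0"
  shows "(\<lambda>k. \<integral>x. (F k x - f x)\<^sup>2 \<partial>M) \<longlonglongrightarrow> 0"
proof -
  have "(\<integral>\<^sup>+x. ennreal ((F k x - f x)\<^sup>2) \<partial>M) = ennreal (\<integral>x. (F k x - f x)\<^sup>2 \<partial>M)" for k
    by (intro nn_integral_eq_integral integrable_square_diff F f Fint fint) simp
  then show ?thesis
    using lim by (simp add: ennreal_tendsto_0_iff)
qed

text \<open>Since \<open>F\<^sup>2 - f\<^sup>2 = (F - f)\<^sup>2 + 2 f (F - f)\<close> and \<open>2 \<bar>f d\<bar> \<le> \<eta> f\<^sup>2 + d\<^sup>2 / \<eta>\<close>, the second moments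
  differ by at most \<open>e + \<eta> \<integral>f\<^sup>2 + e / \<eta>\<close> with \<open>e = \<integral>(F - f)\<^sup>2\<close>; a choice of \<open>\<eta>\<close> just above
  \<open>sqrt e\<close> makes all three terms vanish with \<open>e\<close>.\<close>

lemma L2_tendsto_imp_second_moments_tendsto:
  fixes F :: "nat \<Rightarrow> 'a \<Rightarrow> real"
  assumes F: "\<And>k. F k \<in> borel_measurable M" and f: "f \<in> borel_measurable M"
    and Fint: "\<And>k. integrable M (\<lambda>x. (F k x)\<^sup>2)" and fint: "integrable M (\<lambda>x. (f x)\<^sup>2)"
    and lim: "(\<lambda>k. \<integral>\<^sup>+x. ennreal ((F k x - f x)\<^sup>2) \<partial>M) \<longlonglongrightarrow> 0"
  shows "(\<lambda>k. \<integral>x. (F k x)\<^sup>2 \<partial>M) \<longlonglongrightarrow> (\<integral>x. (f x)\<^sup>2 \<partial>M)"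
proof -
  define e where "e k = (\<integral>x. (F k x - f x)\<^sup>2 \<partial>M)" for k
  define A where "A = (\<integral>x. (f x)\<^sup>2 \<partial>M)"
  define \<eta> where "\<eta> k = sqrt (e k) + 1 / real (Suc k)" for k
  have e0: "e \<longlonglongrightarrow> 0"
    unfolding e_def by (rule L2_tendsto_real[OF F f Fint fint lim])
  have e_nonneg: "0 \<le> e k" for k
    by (simp add: e_def)
  have \<eta>_pos: "0 < \<eta> k" for k
    using e_nonneg[of k] by (simp add: \<eta>_def add_nonneg_pos)
  have \<eta>0: "\<eta> \<longlonglongrightarrow> 0"
    using tendsto_add[OF tendsto_real_sqrt[OF e0] LIMSEQ_Suc[OF lim_1_over_n]]
    by (simp add: \<eta>_def[abs_def])
  have ratio: "e k / \<eta> k \<le> sqrt (e k)" for k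
  proof -
    have "e k = sqrt (e k) * sqrt (e k)"
      using e_nonneg[of k] by simp
    also have "\<dots> \<le> sqrt (e k) * \<eta> k"
      using e_nonneg[of k] by (intro mult_left_mono) (auto simp: \<eta>_def)
    finally show ?thesis
      using \<eta>_pos[of k] by (simp add: field_simps)
  qed
  have dint: "integrable M (\<lambda>x. (F k x - f x)\<^sup>2)" for k
    by (rule integrable_square_diff[OF F f Fint fint])
  have "\<bar>(\<integral>x. (F k x)\<^sup>2 \<partial>M) - A\<bar> \<le> e k + \<eta> k * A + sqrt (e k)" for k
  proof -
    have young: "\<bar>(F k x)\<^sup>2 - (f x)\<^sup>2\<bar> \<le> (F k x - f x)\<^sup>2 + \<eta> k * (f x)\<^sup>2 + (F k x - f x)\<^sup>2 / \<eta> k" for x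
    proof -
      define d where "d = F k x - f x"
      have "0 \<le> (\<eta> k * f x - d)\<^sup>2 / \<eta> k" "0 \<le> (\<eta> k * f x + d)\<^sup>2 / \<eta> k"
        using \<eta>_pos[of k] by auto
      then have "\<bar>2 * f x * d\<bar> \<le> \<eta> k * (f x)\<^sup>2 + d\<^sup>2 / \<eta> k"
        using \<eta>_pos[of k] by (simp add: power2_eq_square field_simps abs_le_iff)
      moreover have "(F k x)\<^sup>2 - (f x)\<^sup>2 = d\<^sup>2 + 2 * f x * d"
        by (simp add: d_def power2_eq_square algebra_simps)
      ultimately show ?thesis
        unfolding d_def[symmetric] using zero_le_power2[of d] by linarith
    qed
    have "\<bar>(\<integral>x. (F k x)\<^sup>2 \<partial>M) - A\<bar> = \<bar>\<integral>x. (F k x)\<^sup>2 - (f x)\<^sup>2 \<partial>M\<bar>"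
      unfolding A_def by (simp add: Fint fint)
    also have "\<dots> \<le> (\<integral>x. \<bar>(F k x)\<^sup>2 - (f x)\<^sup>2\<bar> \<partial>M)"
      by (rule integral_abs_bound)
    also have "\<dots> \<le> (\<integral>x. (F k x - f x)\<^sup>2 + \<eta> k * (f x)\<^sup>2 + (F k x - f x)\<^sup>2 / \<eta> k \<partial>M)"
      using young
      by (intro integral_mono integrable_abs Bochner_Integration.integrable_diff
          Bochner_Integration.integrable_add integrable_mult_right integrable_divide Fint fint dint)
         auto
    also have "\<dots> = e k + \<eta> k * A + e k / \<eta> k"
      by (simp add: e_def A_def dint fint)
    finally show ?thesis
      using ratio[of k] by linarith
  qed
  then have bound: "\<forall>k. norm ((\<integral>x. (F k x)\<^sup>2 \<partial>M) - A) \<le> e k + \<eta> k * A + sqrt (e k)"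
    by (simp only: real_norm_def) blast
  have "(\<lambda>k. e k + \<eta> k * A + sqrt (e k)) \<longlonglongrightarrow> 0"
    using tendsto_add[OF tendsto_add[OF e0 tendsto_mult_right[OF \<eta>0, of A]] tendsto_real_sqrt[OF e0]]
    by simp
  with bound have "(\<lambda>k. (\<integral>x. (F k x)\<^sup>2 \<partial>M) - A) \<longlonglongrightarrow> 0"
    by (rule Lim_null_comparison[OF always_eventually])
  then show ?thesis
    unfolding A_def by (rule LIM_zero_cancel)
qed

lemma (in prob_space) square_integrable_imp_integrable:
  fixes f :: "'a \<Rightarrow> real"
  assumes "f \<in> borel_measurable M" "integrable M (\<lambda>x. (f x)\<^sup>2)"
  shows "integrable M f"
  using integrable_mult_of_square_integrable[of f M "\<lambda>_. 1"] assms by simp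

lemma (in prob_space) L2_tendsto_imp_expectation_tendsto:
  fixes F :: "nat \<Rightarrow> 'a \<Rightarrow> real"
  assumes F: "\<And>k. F k \<in> borel_measurable M" and f: "f \<in> borel_measurable M"
    and Fint: "\<And>k. integrable M (\<lambda>x. (F k x)\<^sup>2)" and fint: "integrable M (\<lambda>x. (f x)\<^sup>2)"
    and lim: "(\<lambda>k. \<integral>\<^sup>+x. ennreal ((F k x - f x)\<^sup>2) \<partial>M) \<longlonglongrightarrow> 0"
  shows "(\<lambda>k. expectation (F k)) \<longlonglongrightarrow> expectation f"
proof -
  have "(expectation (F k) - expectation f)\<^sup>2 \<le> expectation (\<lambda>x. (F k x - f x)\<^sup>2)" for k
  proof -
    have d: "integrable M (\<lambda>x. F k x - f x)"
      by (rule Bochner_Integration.integrable_diff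
          [OF square_integrable_imp_integrable square_integrable_imp_integrable, OF F Fint f fint])
    have "0 \<le> variance (\<lambda>x. F k x - f x)"
      by simp
    also have "\<dots> = expectation (\<lambda>x. (F k x - f x)\<^sup>2) - (expectation (\<lambda>x. F k x - f x))\<^sup>2"
      by (rule variance_eq[OF d integrable_square_diff[OF F f Fint fint]])
    finally show ?thesis
      by (simp add: Bochner_Integration.integral_diff
          [OF square_integrable_imp_integrable square_integrable_imp_integrable, OF F Fint f fint])
  qed
  then have "\<forall>k. norm ((expectation (F k) - expectation f)\<^sup>2) \<le> expectation (\<lambda>x. (F k x - f x)\<^sup>2)"
    by simp
  then have "(\<lambda>k. (expectation (F k) - expectation f)\<^sup>2) \<longlonglongrightarrow> 0"
    by (rule Lim_null_comparison[OF always_eventually L2_tendsto_real[OF F f Fint fint lim]])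
  then have "(\<lambda>k. expectation (F k) - expectation f) \<longlonglongrightarrow> 0"
    by simp
  then show ?thesis
    by (rule LIM_zero_cancel)
qed

text \<open>Weighting the increments \<open>d\<^sub>i = S\<^sub>i\<^sub>+\<^sub>1 - S\<^sub>i\<close> turns mean-square summability into a pathwise bound:
  the Cauchy-Schwarz inequality with weights \<open>r\<^sup>i\<close> gives \<open>(S\<^sub>j - S\<^sub>k)\<^sup>2 \<le> r\<^sup>k / (1 - r) * G\<close> with the
  single dominating function \<open>G = \<Sum>d\<^sub>i\<^sup>2 / r\<^sup>i\<close>. Its integral is finite, because the weights use up only
  one of the two factors \<open>r\<^sup>i\<close> in the rate \<open>(r\<^sup>2)\<^sup>i\<close>.\<close>

lemma L2_limit_of_geometric_increments:
  fixes S :: "nat \<Rightarrow> 'a \<Rightarrow> real"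
  assumes S[measurable]: "\<And>k. S k \<in> borel_measurable M"
    and r: "0 < r" "r < 1" and C: "0 \<le> C"
    and incr: "\<And>k. (\<integral>\<^sup>+x. ennreal ((S (Suc k) x - S k x)\<^sup>2) \<partial>M) \<le> ennreal (C * (r\<^sup>2) ^ k)"
  shows "\<exists>J \<in> borel_measurable M. (\<lambda>k. \<integral>\<^sup>+x. ennreal ((S k x - J x)\<^sup>2) \<partial>M) \<longlonglongrightarrow> 0"
proof -
  define d where "d i x = S (Suc i) x - S i x" for i x
  define G where "G x = (\<Sum>i. ennreal ((d i x)\<^sup>2 / r ^ i))" for x
  have d_meas[measurable]: "d i \<in> borel_measurable M" for i
    unfolding d_def[abs_def] by measurable
  have G_meas[measurable]: "G \<in> borel_measurable M"
    unfolding G_def[abs_def] by measurable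
  have "(\<integral>\<^sup>+x. G x \<partial>M) = (\<Sum>i. \<integral>\<^sup>+x. ennreal ((d i x)\<^sup>2 / r ^ i) \<partial>M)"
    unfolding G_def by (intro nn_integral_suminf) measurable
  also have "\<dots> \<le> (\<Sum>i. ennreal (C * r ^ i))"
  proof (intro suminf_le summableI)
    fix i
    have "(\<integral>\<^sup>+x. ennreal ((d i x)\<^sup>2 / r ^ i) \<partial>M) = (\<integral>\<^sup>+x. ennreal (1 / r ^ i) * ennreal ((d i x)\<^sup>2) \<partial>M)"
      using r by (intro nn_integral_cong) (simp flip: ennreal_mult)
    also have "\<dots> = ennreal (1 / r ^ i) * (\<integral>\<^sup>+x. ennreal ((d i x)\<^sup>2) \<partial>M)"
      by (intro nn_integral_cmult) measurable
    also have "\<dots> \<le> ennreal (1 / r ^ i) * ennreal (C * (r\<^sup>2) ^ i)"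
      using incr[of i] by (intro mult_left_mono) (auto simp: d_def)
    also have "\<dots> = ennreal (C * r ^ i)"
      using r C by (simp add: power_mult_distrib power2_eq_square flip: ennreal_mult)
    finally show "(\<integral>\<^sup>+x. ennreal ((d i x)\<^sup>2 / r ^ i) \<partial>M) \<le> ennreal (C * r ^ i)" .
  qed
  also have "\<dots> = ennreal (\<Sum>i. C * r ^ i)"
    using r C by (intro suminf_ennreal2 summable_mult summable_geometric) auto
  also have "\<dots> < \<infinity>"
    by simp
  finally have G_fin: "(\<integral>\<^sup>+x. G x \<partial>M) < \<infinity>" .
  have AE_G: "AE x in M. G x \<noteq> \<infinity>"
    using G_fin by (intro nn_integral_PInf_AE) auto
  have geo: "(\<Sum>i\<in>{k..<j}. r ^ i) \<le> r ^ k / (1 - r)" if "k \<le> j" for j k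
  proof -
    have "(1 - r) * (\<Sum>i\<in>{k..<j}. r ^ i) = r ^ k - r ^ j"
      using that by (induction j rule: dec_induct) (simp_all add: distrib_left, simp add: algebra_simps)
    then have "(\<Sum>i\<in>{k..<j}. r ^ i) * (1 - r) \<le> r ^ k"
      using r by (simp add: mult.commute)
    then show ?thesis
      using r by (simp add: pos_le_divide_eq)
  qed
  have pathwise: "ennreal ((S j x - S k x)\<^sup>2) \<le> ennreal (r ^ k / (1 - r)) * G x" if "k \<le> j" for j k x
  proof -
    have "S j x - S k x = (\<Sum>i\<in>{k..<j}. d i x)"
      using sum_Suc_diff'[OF that, of "\<lambda>i. S i x"] by (simp add: d_def)
    also have "\<dots> = (\<Sum>i\<in>{k..<j}. sqrt (r ^ i) * (d i x / sqrt (r ^ i)))"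
      using r by (intro sum.cong) auto
    finally have split: "S j x - S k x = (\<Sum>i\<in>{k..<j}. sqrt (r ^ i) * (d i x / sqrt (r ^ i)))" .
    have "(S j x - S k x)\<^sup>2 \<le> (\<Sum>i\<in>{k..<j}. (sqrt (r ^ i))\<^sup>2) * (\<Sum>i\<in>{k..<j}. (d i x / sqrt (r ^ i))\<^sup>2)"
      unfolding split by (rule Cauchy_Schwarz_ineq_sum)
    also have "\<dots> = (\<Sum>i\<in>{k..<j}. r ^ i) * (\<Sum>i\<in>{k..<j}. (d i x)\<^sup>2 / r ^ i)"
      using r by (simp add: power_divide)
    also have "\<dots> \<le> r ^ k / (1 - r) * (\<Sum>i\<in>{k..<j}. (d i x)\<^sup>2 / r ^ i)"
      using r geo[OF that] by (intro mult_right_mono sum_nonneg) auto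
    finally have "ennreal ((S j x - S k x)\<^sup>2)
        \<le> ennreal (r ^ k / (1 - r)) * ennreal (\<Sum>i\<in>{k..<j}. (d i x)\<^sup>2 / r ^ i)"
      using r by (subst ennreal_mult[symmetric]) (auto intro!: sum_nonneg ennreal_leI)
    also have "ennreal (\<Sum>i\<in>{k..<j}. (d i x)\<^sup>2 / r ^ i) = (\<Sum>i\<in>{k..<j}. ennreal ((d i x)\<^sup>2 / r ^ i))"
      using r by (intro sum_ennreal[symmetric]) auto
    also have "\<dots> \<le> G x"
      unfolding G_def by (intro sum_le_suminf) auto
    finally show ?thesis
      by (simp add: mult_left_mono)
  qed
  define J where "J x = lim (\<lambda>k. S k x)" for x
  have J[measurable]: "J \<in> borel_measurable M"
    unfolding J_def[abs_def] by measurable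
  have AE_bound: "AE x in M. \<forall>k. ennreal ((S k x - J x)\<^sup>2) \<le> ennreal (r ^ k / (1 - r)) * G x"
    using AE_G
  proof eventually_elim
    case (elim x)
    then obtain g where g: "G x = ennreal g" "0 \<le> g"
      by (cases "G x") auto
    have bnd: "(S j x - S k x)\<^sup>2 \<le> r ^ k / (1 - r) * g" if "k \<le> j" for j k
      using pathwise[OF that, of x] r g by (simp flip: ennreal_mult)
    have lim0: "(\<lambda>k. r ^ k / (1 - r) * g) \<longlonglongrightarrow> 0"
      using r by (intro tendsto_mult_left_zero tendsto_divide_zero LIMSEQ_power_zero) auto
    have "Cauchy (\<lambda>k. S k x)"
    proof (rule CauchyI')
      fix e :: real assume "0 < e"
      then have "\<forall>\<^sub>F k in sequentially. r ^ k / (1 - r) * g < e\<^sup>2"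
        using lim0 by (intro order_tendstoD(2)) auto
      then obtain N where N: "\<And>k. N \<le> k \<Longrightarrow> r ^ k / (1 - r) * g < e\<^sup>2"
        by (auto simp: eventually_sequentially)
      have "dist (S k x) (S j x) < e" if "N \<le> k" "k < j" for j k
      proof -
        have "\<bar>S j x - S k x\<bar>\<^sup>2 < e\<^sup>2"
          using bnd[of k j] N[of k] that by simp
        then show ?thesis
          using \<open>0 < e\<close> by (simp add: dist_real_def abs_minus_commute power2_less_imp_less)
      qed
      then show "\<exists>N. \<forall>k\<ge>N. \<forall>j>k. dist (S k x) (S j x) < e"
        by blast
    qed
    then have conv: "(\<lambda>j. S j x) \<longlonglongrightarrow> J x"
      unfolding J_def by (simp add: Cauchy_convergent_iff convergent_LIMSEQ_iff)
    show ?case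
    proof
      fix k
      have "(\<lambda>j. (S j x - S k x)\<^sup>2) \<longlonglongrightarrow> (J x - S k x)\<^sup>2"
        by (intro tendsto_intros conv)
      then have "(J x - S k x)\<^sup>2 \<le> r ^ k / (1 - r) * g"
        using bnd by (intro LIMSEQ_le_const2) auto
      then show "ennreal ((S k x - J x)\<^sup>2) \<le> ennreal (r ^ k / (1 - r)) * G x"
        using r g by (simp add: power2_commute[of "S k x"] flip: ennreal_mult)
    qed
  qed
  have "(\<integral>\<^sup>+x. ennreal ((S k x - J x)\<^sup>2) \<partial>M) \<le> ennreal (r ^ k / (1 - r)) * (\<integral>\<^sup>+x. G x \<partial>M)" for k
    using AE_bound
    by (subst nn_integral_cmult[symmetric]) (auto intro!: nn_integral_mono_AE)
  moreover have "(\<lambda>k. ennreal (r ^ k / (1 - r)) * (\<integral>\<^sup>+x. G x \<partial>M)) \<longlonglongrightarrow> 0"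
  proof -
    obtain g where g: "(\<integral>\<^sup>+x. G x \<partial>M) = ennreal g" "0 \<le> g"
      using G_fin by (cases "\<integral>\<^sup>+x. G x \<partial>M") auto
    have "(\<lambda>k. r ^ k / (1 - r) * g) \<longlonglongrightarrow> 0"
      using r by (intro tendsto_mult_left_zero tendsto_divide_zero LIMSEQ_power_zero) auto
    then have "(\<lambda>k. ennreal (r ^ k / (1 - r) * g)) \<longlonglongrightarrow> 0"
      using r g by (simp add: ennreal_tendsto_0_iff)
    then show ?thesis
      using r g by (simp add: ennreal_mult'[symmetric])
  qed
  ultimately have "(\<lambda>k. \<integral>\<^sup>+x. ennreal ((S k x - J x)\<^sup>2) \<partial>M) \<longlonglongrightarrow> 0"
    by (rule tendsto_sandwich[OF always_eventually always_eventually tendsto_const, OF allI allI, OF zero_le])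
  then show ?thesis
    using J by blast
qed

section \<open>Isometry of step integrals\<close>

lemma partition_of_mono:
  assumes "partition_of a b n p" "i \<le> j" "j \<le> n"
  shows "p i \<le> p j"
  using assms(2,3)
proof (induction j rule: dec_induct)
  case (step m)
  then have "p m \<le> p (Suc m)"
    using assms(1) by (auto simp: partition_of_def)
  with step show ?case
    by auto
qed simp

lemma partition_of_bounds:
  assumes "partition_of a b n p" "i \<le> n"
  shows "a \<le> p i" "p i \<le> b"
  using partition_of_mono[OF assms(1), of 0 i] partition_of_mono[OF assms(1), of i n] assms
  by (auto simp: partition_of_def)

lemma partition_of_cover:
  assumes "partition_of a b n p" "a < z" "z \<le> b"
  obtains i where "i < n" "p i < z" "z \<le> p (Suc i)"
proof -
  have "\<exists>i<m. p i < z \<and> z \<le> p (Suc i)" if "m \<le> n" "z \<le> p m" for m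
    using that
  proof (induction m)
    case 0
    then show ?case
      using assms by (auto simp: partition_of_def)
  next
    case (Suc m)
    then show ?case
      by (cases "z \<le> p m") (auto simp: less_Suc_eq)
  qed
  from this[of n] that show thesis
    using assms by (auto simp: partition_of_def)
qed

lemma step_fun_eq:
  assumes "partition_of a b n p" "i < n" "p i < z" "z \<le> p (Suc i)"
  shows "step_fun n p c z = c i"
proof -
  have "z \<notin> {p j<..p (Suc j)}" if "j < n" "j \<noteq> i" for j
    using partition_of_mono[OF assms(1), of "Suc j" i] partition_of_mono[OF assms(1), of "Suc i" j]
      assms that by (cases "j < i") auto
  then have "step_fun n p c z = (\<Sum>j<n. if j = i then c i else 0)"
    using assms unfolding step_fun_def by (intro sum.cong) auto
  then show ?thesis
    using assms by simp
qed

text \<open>The isometry is a statement about second moments of increments. This form is shared by Brownian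
  motion on its probability space and by the family \<open>indicator {..s}\<close> on the real line with Lebesgue
  measure, whose step integrals are the step functions.\<close>

locale isometric_increments =
  fixes M :: "'a measure" and X :: "real \<Rightarrow> 'a \<Rightarrow> real" and a b :: real
  assumes increment_measurable: "\<And>s u. a \<le> s \<Longrightarrow> s \<le> u \<Longrightarrow> u \<le> b \<Longrightarrow>
      (\<lambda>\<omega>. X u \<omega> - X s \<omega>) \<in> borel_measurable M"
    and increment_square_integrable: "\<And>s u. a \<le> s \<Longrightarrow> s \<le> u \<Longrightarrow> u \<le> b \<Longrightarrow>
      integrable M (\<lambda>\<omega>. (X u \<omega> - X s \<omega>)\<^sup>2)"
    and increment_second_moment: "\<And>s u. a \<le> s \<Longrightarrow> s \<le> u \<Longrightarrow> u \<le> b \<Longrightarrow>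
      (\<integral>\<omega>. (X u \<omega> - X s \<omega>)\<^sup>2 \<partial>M) = u - s"
begin

lemma increments_product_integrable:
  assumes "a \<le> s" "s \<le> u" "u \<le> b" "a \<le> v" "v \<le> w" "w \<le> b"
  shows "integrable M (\<lambda>\<omega>. (X u \<omega> - X s \<omega>) * (X w \<omega> - X v \<omega>))"
  using assms by (intro integrable_mult_of_square_integrable increment_measurable increment_square_integrable)

text \<open>Polarization: for adjacent intervals, expanding the square of the increment over their union
  leaves no room for a cross term, because lengths add.\<close>

lemma increments_orthogonal:
  assumes "a \<le> s" "s \<le> u" "u \<le> v" "v \<le> w" "w \<le> b"
  shows "(\<integral>\<omega>. (X u \<omega> - X s \<omega>) * (X w \<omega> - X v \<omega>) \<partial>M) = 0"
proof -
  have adjacent: "(\<integral>\<omega>. (X u \<omega> - X s \<omega>) * (X w \<omega> - X u \<omega>) \<partial>M) = 0"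
    if "u \<le> w" "w \<le> b" for w
  proof -
    have "w - s = (\<integral>\<omega>. (X w \<omega> - X s \<omega>)\<^sup>2 \<partial>M)"
      using assms that by (intro increment_second_moment[symmetric]) auto
    also have "\<dots> = (\<integral>\<omega>. (X u \<omega> - X s \<omega>)\<^sup>2 + (X w \<omega> - X u \<omega>)\<^sup>2
        + 2 * ((X u \<omega> - X s \<omega>) * (X w \<omega> - X u \<omega>)) \<partial>M)"
      by (intro Bochner_Integration.integral_cong) (auto simp: power2_eq_square algebra_simps)
    also have "\<dots> = (u - s) + (w - u) + 2 * (\<integral>\<omega>. (X u \<omega> - X s \<omega>) * (X w \<omega> - X u \<omega>) \<partial>M)"
      using assms that
      by (simp add: increment_second_moment increment_square_integrable increments_product_integrable)
    finally show ?thesis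
      by simp
  qed
  have "(\<integral>\<omega>. (X u \<omega> - X s \<omega>) * (X w \<omega> - X v \<omega>) \<partial>M)
      = (\<integral>\<omega>. (X u \<omega> - X s \<omega>) * (X w \<omega> - X u \<omega>) - (X u \<omega> - X s \<omega>) * (X v \<omega> - X u \<omega>) \<partial>M)"
    by (intro Bochner_Integration.integral_cong) (auto simp: algebra_simps)
  also have "\<dots> = 0"
    using assms adjacent[of w] adjacent[of v]
    by (subst Bochner_Integration.integral_diff) (auto intro!: increments_product_integrable)
  finally show ?thesis .
qed

lemma step_integral_measurable:
  assumes "partition_of a b n p"
  shows "step_integral X n p c \<in> borel_measurable M"
  unfolding step_integral_def[abs_def]
  using partition_of_bounds[OF assms] partition_of_mono[OF assms]
  by (intro borel_measurable_sum borel_measurable_times borel_measurable_const increment_measurable)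
     (auto simp: Suc_le_eq)

lemma step_integral_isometry:
  assumes p: "partition_of a b n p"
  shows "integrable M (\<lambda>\<omega>. (step_integral X n p c \<omega>)\<^sup>2)"
    and "(\<integral>\<omega>. (step_integral X n p c \<omega>)\<^sup>2 \<partial>M) = (\<Sum>i<n. (c i)\<^sup>2 * (p (Suc i) - p i))"
proof -
  define D where "D i \<omega> = X (p (Suc i)) \<omega> - X (p i) \<omega>" for i \<omega>
  have bounds: "a \<le> p i" "p i \<le> p (Suc i)" "p (Suc i) \<le> b" if "i < n" for i
    using partition_of_bounds[OF p] partition_of_mono[OF p, of i "Suc i"] that by (auto simp: Suc_le_eq)
  have int: "integrable M (\<lambda>\<omega>. D i \<omega> * D j \<omega>)" if "i < n" "j < n" for i j
    unfolding D_def using bounds that by (intro increments_product_integrable) auto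
  have ortho: "(\<integral>\<omega>. D i \<omega> * D j \<omega> \<partial>M) = 0" if "i < j" "j < n" for i j
    unfolding D_def using bounds[of i] bounds[of j] partition_of_mono[OF p, of "Suc i" j] that
    by (intro increments_orthogonal) auto
  have cov: "(\<integral>\<omega>. D i \<omega> * D j \<omega> \<partial>M) = (if i = j then p (Suc i) - p i else 0)"
    if "i < n" "j < n" for i j
  proof (cases i j rule: linorder_cases)
    case equal
    then show ?thesis
      using increment_second_moment[OF bounds, of j] that by (simp add: D_def power2_eq_square)
  next
    case greater
    then show ?thesis
      using ortho[of j i] that by (simp add: mult.commute)
  qed (use ortho[of i j] that in simp)
  have expand: "(step_integral X n p c \<omega>)\<^sup>2 = (\<Sum>i<n. \<Sum>j<n. (c i * c j) * (D i \<omega> * D j \<omega>))" for \<omega>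
    unfolding step_integral_def D_def power2_eq_square sum_product
    by (intro sum.cong refl) (simp add: ac_simps)
  show "integrable M (\<lambda>\<omega>. (step_integral X n p c \<omega>)\<^sup>2)"
    unfolding expand
    by (intro Bochner_Integration.integrable_sum integrable_mult_right int) auto
  have "(\<integral>\<omega>. (step_integral X n p c \<omega>)\<^sup>2 \<partial>M)
      = (\<Sum>i<n. \<Sum>j<n. (c i * c j) * (\<integral>\<omega>. D i \<omega> * D j \<omega> \<partial>M))"
    unfolding expand
    by (subst Bochner_Integration.integral_sum, (intro Bochner_Integration.integrable_sum integrable_mult_right int; simp),
        intro sum.cong refl, subst Bochner_Integration.integral_sum, (intro integrable_mult_right int; simp)) simp
  also have "\<dots> = (\<Sum>i<n. \<Sum>j<n. if j = i then (c i)\<^sup>2 * (p (Suc i) - p i) else 0)"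
    by (intro sum.cong refl) (auto simp: cov power2_eq_square)
  also have "\<dots> = (\<Sum>i<n. (c i)\<^sup>2 * (p (Suc i) - p i))"
    by simp
  finally show "(\<integral>\<omega>. (step_integral X n p c \<omega>)\<^sup>2 \<partial>M) = (\<Sum>i<n. (c i)\<^sup>2 * (p (Suc i) - p i))" .
qed

end

text \<open>By this instance the squared norm of a step function is computed by the same sum as the second
  moment of its step integral, which is the isometry.\<close>

lemma isometric_increments_indicator:
  "isometric_increments lborel (\<lambda>s. indicator {..s} :: real \<Rightarrow> real) a b"
proof -
  have eq: "indicator {..u} z - indicator {..s} z = (indicator {s<..u} z :: real)" if "s \<le> u" for s u z :: real
    using that by (auto split: split_indicator)
  show ?thesis
    by standard (simp_all add: eq power2_eq_square flip: indicator_inter_arith)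
qed

lemma step_fun_eq_step_integral:
  assumes "partition_of a b n p"
  shows "step_fun n p c = step_integral (\<lambda>s. indicator {..s}) n p c"
proof
  fix z
  have "p i \<le> p (Suc i)" if "i < n" for i
    using partition_of_mono[OF assms, of i "Suc i"] that by simp
  then have "indicator {p i<..p (Suc i)} z = (indicator {..p (Suc i)} z - indicator {..p i} z :: real)"
    if "i < n" for i
    using that by (fastforce split: split_indicator)
  then show "step_fun n p c z = step_integral (\<lambda>s. indicator {..s}) n p c z"
    unfolding step_fun_def step_integral_def by (intro sum.cong refl) simp
qed

lemma step_fun_outside:
  assumes "partition_of a b n p" "z \<notin> {a..b}"
  shows "step_fun n p c z = 0"
  unfolding step_fun_def
proof (intro sum.neutral ballI)
  fix i assume "i \<in> {..<n}"
  then have "a \<le> p i" "p (Suc i) \<le> b"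
    using partition_of_bounds[OF assms(1)] by (auto simp: Suc_le_eq)
  then show "c i * indicator {p i<..p (Suc i)} z = 0"
    using assms(2) by auto
qed

section \<open>The Wiener integral: isometry and existence\<close>

text \<open>The step integrals and the step functions have the same second moments, and both sequences of
  second moments pass to their limits.\<close>

lemma has_wiener_integral_second_moment:
  assumes X: "isometric_increments M X a b"
    and J: "has_wiener_integral M X f a b J"
    and f2: "set_integrable lborel {a..b} (\<lambda>z. (f z)\<^sup>2)"
  shows "(\<integral>\<omega>. (J \<omega>)\<^sup>2 \<partial>M) = (LINT z:{a..b}|lborel. (f z)\<^sup>2)"
proof -
  interpret X: isometric_increments M X a b
    by (rule X)
  interpret I: isometric_increments lborel "\<lambda>s. indicator {..s} :: real \<Rightarrow> real" a b
    by (rule isometric_increments_indicator)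
  obtain n p c where p: "\<And>k. partition_of a b (n k) (p k)"
    and step: "(\<lambda>k. \<integral>\<^sup>+z\<in>{a..b}. ennreal ((step_fun (n k) (p k) (c k) z - f z)\<^sup>2) \<partial>lborel) \<longlonglongrightarrow> 0"
    and int: "(\<lambda>k. \<integral>\<^sup>+\<omega>. ennreal ((step_integral X (n k) (p k) (c k) \<omega> - J \<omega>)\<^sup>2) \<partial>M) \<longlonglongrightarrow> 0"
    using J unfolding has_wiener_integral_def by blast
  define F where "F k = step_fun (n k) (p k) (c k)" for k
  define g where "g z = indicator {a..b} z * f z" for z
  have F_eq: "F k = step_integral (\<lambda>s. indicator {..s}) (n k) (p k) (c k)" for k
    unfolding F_def by (rule step_fun_eq_step_integral[OF p])
  have g2: "(g z)\<^sup>2 = indicator {a..b} z * (f z)\<^sup>2" for z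
    by (auto simp: g_def split: split_indicator)
  have "(\<lambda>k. \<integral>\<^sup>+z. ennreal ((F k z - g z)\<^sup>2) \<partial>lborel) \<longlonglongrightarrow> 0"
  proof -
    have "(F k z - g z)\<^sup>2 = (F k z - f z)\<^sup>2 * indicator {a..b} z" for k z
      using step_fun_outside[OF p, of z k] by (cases "z \<in> {a..b}") (auto simp: g_def F_def)
    then have "ennreal ((F k z - g z)\<^sup>2) = ennreal ((F k z - f z)\<^sup>2) * indicator {a..b} z" for k z
      by (auto split: split_indicator)
    then show ?thesis
      using step by (simp add: F_def)
  qed
  then have "(\<lambda>k. \<integral>z. (F k z)\<^sup>2 \<partial>lborel) \<longlonglongrightarrow> (\<integral>z. (g z)\<^sup>2 \<partial>lborel)"
  proof (rule L2_tendsto_imp_second_moments_tendsto[rotated 4])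
    show "F k \<in> borel_measurable lborel" "integrable lborel (\<lambda>z. (F k z)\<^sup>2)" for k
      unfolding F_eq by (intro I.step_integral_measurable[OF p] I.step_integral_isometry(1)[OF p])+
    show "g \<in> borel_measurable lborel"
      using J by (simp add: has_wiener_integral_def set_borel_measurable_def g_def[abs_def])
    show "integrable lborel (\<lambda>z. (g z)\<^sup>2)"
      using f2 by (simp add: set_integrable_def g2)
  qed
  moreover have "(\<integral>z. (g z)\<^sup>2 \<partial>lborel) = (LINT z:{a..b}|lborel. (f z)\<^sup>2)"
    by (simp add: g2 set_lebesgue_integral_def)
  moreover have "(\<integral>z. (F k z)\<^sup>2 \<partial>lborel) = (\<integral>\<omega>. (step_integral X (n k) (p k) (c k) \<omega>)\<^sup>2 \<partial>M)" for k
    unfolding F_eq I.step_integral_isometry(2)[OF p] X.step_integral_isometry(2)[OF p] ..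
  moreover have "(\<lambda>k. \<integral>\<omega>. (step_integral X (n k) (p k) (c k) \<omega>)\<^sup>2 \<partial>M) \<longlonglongrightarrow> (\<integral>\<omega>. (J \<omega>)\<^sup>2 \<partial>M)"
    using J int
    by (intro L2_tendsto_imp_second_moments_tendsto X.step_integral_measurable[OF p]
        X.step_integral_isometry(1)[OF p]) (auto simp: has_wiener_integral_def)
  ultimately show ?thesis
    by (auto intro: LIMSEQ_unique)
qed

lemma (in prob_space) has_wiener_integral_expectation:
  assumes X: "isometric_increments M X a b"
    and mean: "\<And>s u. a \<le> s \<Longrightarrow> s \<le> u \<Longrightarrow> u \<le> b \<Longrightarrow> expectation (\<lambda>\<omega>. X u \<omega> - X s \<omega>) = 0"
    and J: "has_wiener_integral M X f a b J"
  shows "expectation J = 0"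
proof -
  interpret X: isometric_increments M X a b
    by (rule X)
  obtain n p c where p: "\<And>k. partition_of a b (n k) (p k)"
    and int: "(\<lambda>k. \<integral>\<^sup>+\<omega>. ennreal ((step_integral X (n k) (p k) (c k) \<omega> - J \<omega>)\<^sup>2) \<partial>M) \<longlonglongrightarrow> 0"
    using J unfolding has_wiener_integral_def by blast
  have "expectation (step_integral X (n k) (p k) (c k)) = 0" for k
  proof -
    have "a \<le> p k i" "p k i \<le> p k (Suc i)" "p k (Suc i) \<le> b" if "i < n k" for i
      using partition_of_bounds[OF p] partition_of_mono[OF p, of i "Suc i"] that by (auto simp: Suc_le_eq)
    moreover have "integrable M (\<lambda>\<omega>. X u \<omega> - X s \<omega>)" if "a \<le> s" "s \<le> u" "u \<le> b" for s u
      by (rule square_integrable_imp_integrable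
          [OF X.increment_measurable X.increment_square_integrable, OF that that])
    ultimately show ?thesis
      unfolding step_integral_def
      by (simp add: mean)
  qed
  moreover have "(\<lambda>k. expectation (step_integral X (n k) (p k) (c k))) \<longlonglongrightarrow> expectation J"
    using J int
    by (intro L2_tendsto_imp_expectation_tendsto X.step_integral_measurable[OF p]
        X.step_integral_isometry(1)[OF p]) (auto simp: has_wiener_integral_def)
  ultimately show ?thesis
    by (simp add: LIMSEQ_const_iff)
qed

text \<open>Modification at the left endpoint is what the conga line needs: at \<open>z = 0\<close> its integrand takes
  the default value \<open>Phi_bar 0\<close>, although it tends to \<open>0\<close> as \<open>z\<close> decreases to \<open>0\<close> when \<open>x > 0\<close>, so it is
  not monotone.\<close>

lemma has_wiener_integral_cong:
  assumes f: "has_wiener_integral M X f a b J"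
    and g: "set_borel_measurable lborel {a..b} g"
    and eq: "\<And>z. a < z \<Longrightarrow> z \<le> b \<Longrightarrow> f z = g z"
  shows "has_wiener_integral M X g a b J"
proof -
  have "(\<integral>\<^sup>+z\<in>{a..b}. ennreal ((s z - f z)\<^sup>2) \<partial>lborel) = (\<integral>\<^sup>+z\<in>{a..b}. ennreal ((s z - g z)\<^sup>2) \<partial>lborel)"
    for s :: "real \<Rightarrow> real"
  proof (rule nn_integral_cong_AE)
    show "AE z in lborel. ennreal ((s z - f z)\<^sup>2) * indicator {a..b} z
        = ennreal ((s z - g z)\<^sup>2) * indicator {a..b} z"
      using AE_lborel_singleton[of a] by eventually_elim (auto simp: eq split: split_indicator)
  qed
  with f g show ?thesis
    unfolding has_wiener_integral_def by simp
qed

lemma sum_lessThan_double: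
  fixes g :: "nat \<Rightarrow> 'b::comm_monoid_add"
  shows "(\<Sum>j<2 * n. g j) = (\<Sum>i<n. g (2 * i) + g (Suc (2 * i)))"
  by (induction n) (auto simp: ac_simps)

lemma step_integral_refine:
  assumes "\<And>i. i \<le> n \<Longrightarrow> q (2 * i) = p i"
  shows "step_integral X n p c = step_integral X (2 * n) q (\<lambda>j. c (j div 2))"
proof
  fix \<omega>
  have "q (2 * i) = p i" "q (Suc (Suc (2 * i))) = p (Suc i)" if "i < n" for i
    using assms[of i] assms[of "Suc i"] that by auto
  then show "step_integral X n p c \<omega> = step_integral X (2 * n) q (\<lambda>j. c (j div 2)) \<omega>"
    unfolding step_integral_def sum_lessThan_double
    by (intro sum.cong refl) (simp add: algebra_simps)
qed

text \<open>Sample \<open>f\<close> at the left endpoints of the \<open>k\<close>-th dyadic partition. With \<open>B = f b - f a\<close>, a squared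
  oscillation is at most \<open>B\<close> times the oscillation over the enclosing cell, and the oscillations over
  the cells telescope to \<open>B\<close>. So both the squared distance of the step function from \<open>f\<close> and the second
  moment of the difference of consecutive step integrals are at most \<open>B\<^sup>2 (b - a) / 2 ^ k\<close>, a
  geometric rate.\<close>

lemma has_wiener_integral_mono_on_exists:
  assumes X: "isometric_increments M X a b"
    and "a \<le> b" and f: "mono_on {a..b} f"
  shows "\<exists>J. has_wiener_integral M X f a b J"
proof -
  interpret X: isometric_increments M X a b
    by (rule X)
  define p where "p k i = a + (b - a) * real i / 2 ^ k" for k i :: nat
  define c where "c k i = f (p k i)" for k i :: nat
  define B where "B = f b - f a"
  define S where "S k = step_integral X (2 ^ k) (p k) (c k)" for k
  have width: "p k (Suc i) - p k i = (b - a) / 2 ^ k" for k i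
    by (simp add: p_def diff_divide_distrib[symmetric] algebra_simps)
  have p: "partition_of a b (2 ^ k) (p k)" for k
    using \<open>a \<le> b\<close> by (auto simp: partition_of_def p_def intro!: divide_right_mono mult_left_mono)
  have p_refine: "p (Suc k) (2 * i) = p k i" for k i
    by (simp add: p_def)
  have f_mono: "f z \<le> f w" if "a \<le> z" "z \<le> w" "w \<le> b" for z w
    using mono_onD[OF f, of z w] that by auto
  have B_nonneg: "0 \<le> B"
    using f_mono[of a b] \<open>a \<le> b\<close> by (simp add: B_def)
  have square_le: "(f w - f z)\<^sup>2 \<le> B * (f v - f u)"
    if "a \<le> u" "u \<le> z" "z \<le> w" "w \<le> v" "v \<le> b" for u z w v
  proof -
    have "0 \<le> f w - f z" "f w - f z \<le> B" "f w - f z \<le> f v - f u"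
      using f_mono[of a z] f_mono[of w b] f_mono[of u z] f_mono[of w v] f_mono[of z w] that
      by (auto simp: B_def)
    then show ?thesis
      unfolding power2_eq_square by (intro mult_mono) auto
  qed
  have telescope: "(\<Sum>i<2 ^ k. c k (Suc i) - c k i) = B" for k
    using sum_lessThan_telescope[of "c k" "2 ^ k"] by (simp add: c_def p_def B_def)
  have pb: "a \<le> p k i" "p k i \<le> p k (Suc i)" "p k (Suc i) \<le> b" if "i < 2 ^ k" for k i
    using partition_of_bounds[OF p, of _ k] partition_of_mono[OF p, of i "Suc i" k] that
    by (auto simp: Suc_le_eq)
  have c_incr: "0 \<le> c k (Suc i) - c k i" if "i < 2 ^ k" for k i
    using f_mono[OF pb[OF that]] by (simp add: c_def)

  have f_meas: "set_borel_measurable lborel {a..b} f"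
    using borel_measurable_mono_on_fnc[OF f]
    by (simp add: set_borel_measurable_def borel_measurable_restrict_space_iff mult.commute)

  have error: "(\<integral>\<^sup>+z\<in>{a..b}. ennreal ((step_fun (2 ^ k) (p k) (c k) z - f z)\<^sup>2) \<partial>lborel)
      \<le> ennreal (B\<^sup>2 * (b - a) / 2 ^ k)" for k
  proof -
    have "(\<integral>\<^sup>+z\<in>{a..b}. ennreal ((step_fun (2 ^ k) (p k) (c k) z - f z)\<^sup>2) \<partial>lborel)
        \<le> (\<integral>\<^sup>+z. (\<Sum>i<2 ^ k. ennreal (B * (c k (Suc i) - c k i)) * indicator {p k i<..p k (Suc i)} z) \<partial>lborel)"
    proof (rule nn_integral_mono_AE)
      show "AE z in lborel. ennreal ((step_fun (2 ^ k) (p k) (c k) z - f z)\<^sup>2) * indicator {a..b} z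
          \<le> (\<Sum>i<2 ^ k. ennreal (B * (c k (Suc i) - c k i)) * indicator {p k i<..p k (Suc i)} z)"
        using AE_lborel_singleton[of a]
      proof eventually_elim
        case (elim z)
        show ?case
        proof (cases "z \<in> {a..b}")
          case True
          then obtain i where i: "i < 2 ^ k" "p k i < z" "z \<le> p k (Suc i)"
            using partition_of_cover[OF p, of z k] elim by force
          have "(step_fun (2 ^ k) (p k) (c k) z - f z)\<^sup>2 = (f z - f (p k i))\<^sup>2"
            by (simp add: step_fun_eq[OF p i] c_def power2_commute)
          also have "\<dots> \<le> B * (c k (Suc i) - c k i)"
            unfolding c_def using pb[OF i(1)] i by (intro square_le) auto
          finally have "ennreal ((step_fun (2 ^ k) (p k) (c k) z - f z)\<^sup>2) * indicator {a..b} z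
              \<le> ennreal (B * (c k (Suc i) - c k i)) * indicator {p k i<..p k (Suc i)} z"
            using True i by (auto intro!: ennreal_leI)
          also have "\<dots> \<le> (\<Sum>i<2 ^ k. ennreal (B * (c k (Suc i) - c k i)) * indicator {p k i<..p k (Suc i)} z)"
            using i by (intro member_le_sum) auto
          finally show ?thesis .
        qed simp
      qed
    qed
    also have "\<dots> = (\<Sum>i<2 ^ k. \<integral>\<^sup>+z. ennreal (B * (c k (Suc i) - c k i)) * indicator {p k i<..p k (Suc i)} z \<partial>lborel)"
      by (rule nn_integral_sum) simp
    also have "\<dots> = (\<Sum>i<2 ^ k. ennreal (B * (c k (Suc i) - c k i) * ((b - a) / 2 ^ k)))"
    proof (rule sum.cong[OF refl])
      fix i :: nat assume "i \<in> {..<2 ^ k}"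
      then have i: "i < 2 ^ k"
        by simp
      have nonneg: "0 \<le> B * (c k (Suc i) - c k i)"
        using B_nonneg c_incr[OF i] by (rule mult_nonneg_nonneg)
      then show "(\<integral>\<^sup>+z. ennreal (B * (c k (Suc i) - c k i)) * indicator {p k i<..p k (Suc i)} z \<partial>lborel)
          = ennreal (B * (c k (Suc i) - c k i) * ((b - a) / 2 ^ k))"
        unfolding ennreal_mult'[OF nonneg] using pb(2)[OF i]
        by (simp add: nn_integral_cmult_indicator width)
    qed
    also have "\<dots> = ennreal (\<Sum>i<2 ^ k. B * (c k (Suc i) - c k i) * ((b - a) / 2 ^ k))"
    proof (rule sum_ennreal)
      fix i :: nat assume "i \<in> {..<2 ^ k}"
      then show "0 \<le> B * (c k (Suc i) - c k i) * ((b - a) / 2 ^ k)"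
        using B_nonneg \<open>a \<le> b\<close> by (intro mult_nonneg_nonneg c_incr divide_nonneg_nonneg) simp_all
    qed
    also have "(\<Sum>i<2 ^ k. B * (c k (Suc i) - c k i) * ((b - a) / 2 ^ k)) = B\<^sup>2 * (b - a) / 2 ^ k"
      unfolding sum_distrib_right[symmetric] sum_distrib_left[symmetric] telescope
      by (simp add: power2_eq_square)
    finally show ?thesis .
  qed
  have "(\<lambda>k. B\<^sup>2 * (b - a) * (1 / 2) ^ k) \<longlonglongrightarrow> 0"
    by (intro tendsto_mult_right_zero LIMSEQ_power_zero) simp
  then have "(\<lambda>k. ennreal (B\<^sup>2 * (b - a) / 2 ^ k)) \<longlonglongrightarrow> 0"
    using \<open>a \<le> b\<close> by (subst ennreal_tendsto_0_iff) (auto simp: power_one_over)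
  then have step_lim: "(\<lambda>k. \<integral>\<^sup>+z\<in>{a..b}. ennreal ((step_fun (2 ^ k) (p k) (c k) z - f z)\<^sup>2) \<partial>lborel) \<longlonglongrightarrow> 0"
    by (rule tendsto_sandwich[OF always_eventually always_eventually tendsto_const, OF allI allI, OF zero_le error])

  have S_meas: "S k \<in> borel_measurable M" and S_int: "integrable M (\<lambda>\<omega>. (S k \<omega>)\<^sup>2)" for k
    unfolding S_def by (intro X.step_integral_measurable[OF p] X.step_integral_isometry(1)[OF p])+
  have incr: "(\<integral>\<^sup>+\<omega>. ennreal ((S (Suc k) \<omega> - S k \<omega>)\<^sup>2) \<partial>M) \<le> ennreal (B\<^sup>2 * (b - a) * ((sqrt (1 / 2))\<^sup>2) ^ k)" for k
  proof -
    \<comment> \<open>On the refined partition the coefficients \<open>e\<close> of the difference vanish in every left half cell.\<close>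
    define e where "e j = c (Suc k) j - c k (j div 2)" for j
    have diff: "S (Suc k) \<omega> - S k \<omega> = step_integral X (2 ^ Suc k) (p (Suc k)) e \<omega>" for \<omega>
      unfolding S_def step_integral_refine[of "2 ^ k" "p (Suc k)" "p k", OF p_refine]
      by (simp add: step_integral_def e_def sum_subtractf left_diff_distrib)
    have "(\<integral>\<omega>. (S (Suc k) \<omega> - S k \<omega>)\<^sup>2 \<partial>M) = (\<Sum>j<2 * 2 ^ k. (e j)\<^sup>2 * ((b - a) / 2 ^ Suc k))"
      unfolding diff X.step_integral_isometry(2)[OF p] width by simp
    also have "\<dots> = (\<Sum>i<2 ^ k. (e (Suc (2 * i)))\<^sup>2 * ((b - a) / 2 ^ Suc k))"
      unfolding sum_lessThan_double by (simp add: e_def c_def p_refine)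
    also have "\<dots> \<le> (\<Sum>i<2 ^ k. B * (c k (Suc i) - c k i) * ((b - a) / 2 ^ Suc k))"
    proof (intro sum_mono mult_right_mono)
      fix i :: nat assume "i \<in> {..<2 ^ k}"
      then have i: "i < 2 ^ k"
        by simp
      have "p k i \<le> p (Suc k) (Suc (2 * i))" "p (Suc k) (Suc (2 * i)) \<le> p k (Suc i)"
        using pb[of "2 * i" "Suc k"] pb[of "Suc (2 * i)" "Suc k"] i
          p_refine[of k i] p_refine[of k "Suc i"] by auto
      then have "(f (p (Suc k) (Suc (2 * i))) - f (p k i))\<^sup>2 \<le> B * (f (p k (Suc i)) - f (p k i))"
        using pb[OF i] by (intro square_le) auto
      then show "(e (Suc (2 * i)))\<^sup>2 \<le> B * (c k (Suc i) - c k i)"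
        by (simp add: e_def c_def)
    qed (use \<open>a \<le> b\<close> in simp)
    also have "\<dots> = B\<^sup>2 * (b - a) / 2 ^ Suc k"
      unfolding sum_distrib_right[symmetric] sum_distrib_left[symmetric] telescope
      by (simp add: power2_eq_square)
    also have "\<dots> = B\<^sup>2 * (b - a) * (1 / 2) ^ k / 2"
      by (simp add: power_one_over)
    also have "\<dots> \<le> B\<^sup>2 * (b - a) * (1 / 2) ^ k"
    proof -
      have "0 \<le> B\<^sup>2 * (b - a) * (1 / 2) ^ k"
        using \<open>a \<le> b\<close> by simp
      then show ?thesis
        by linarith
    qed
    finally have "(\<integral>\<omega>. (S (Suc k) \<omega> - S k \<omega>)\<^sup>2 \<partial>M) \<le> B\<^sup>2 * (b - a) * ((sqrt (1 / 2))\<^sup>2) ^ k"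
      by simp
    moreover have "(\<integral>\<^sup>+\<omega>. ennreal ((S (Suc k) \<omega> - S k \<omega>)\<^sup>2) \<partial>M)
        = ennreal (\<integral>\<omega>. (S (Suc k) \<omega> - S k \<omega>)\<^sup>2 \<partial>M)"
      by (intro nn_integral_eq_integral integrable_square_diff S_meas S_int) simp
    ultimately show ?thesis
      by (simp add: ennreal_leI)
  qed
  have "\<exists>J \<in> borel_measurable M. (\<lambda>k. \<integral>\<^sup>+\<omega>. ennreal ((S k \<omega> - J \<omega>)\<^sup>2) \<partial>M) \<longlonglongrightarrow> 0"
    using \<open>a \<le> b\<close>
    by (intro L2_limit_of_geometric_increments[OF S_meas _ _ _ incr]) (auto simp: real_sqrt_divide)
  then obtain J where J: "J \<in> borel_measurable M"
    and lim: "(\<lambda>k. \<integral>\<^sup>+\<omega>. ennreal ((S k \<omega> - J \<omega>)\<^sup>2) \<partial>M) \<longlonglongrightarrow> 0"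
    by blast
  have "integrable M (\<lambda>\<omega>. (J \<omega>)\<^sup>2)"
  proof -
    have "\<forall>\<^sub>F k in sequentially. (\<integral>\<^sup>+\<omega>. ennreal ((S k \<omega> - J \<omega>)\<^sup>2) \<partial>M) < 1"
      using lim by (rule order_tendstoD) simp
    then obtain k where "(\<integral>\<^sup>+\<omega>. ennreal ((S k \<omega> - J \<omega>)\<^sup>2) \<partial>M) < 1"
      by (auto simp: eventually_sequentially)
    then have "(\<integral>\<^sup>+\<omega>. ennreal ((S k \<omega> - J \<omega>)\<^sup>2) \<partial>M) < \<infinity>"
      by (rule less_trans) simp
    then have "integrable M (\<lambda>\<omega>. (S k \<omega> - J \<omega>)\<^sup>2)"
      using S_meas[of k] J by (intro integrableI_nonneg) auto
    then have "integrable M (\<lambda>\<omega>. (S k \<omega> - (S k \<omega> - J \<omega>))\<^sup>2)"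
      by (intro integrable_square_diff[of "S k" M "\<lambda>\<omega>. S k \<omega> - J \<omega>"]
          borel_measurable_diff S_meas S_int J)
    then show ?thesis
      by simp
  qed
  then have "has_wiener_integral M X f a b J"
    unfolding has_wiener_integral_def
    by (intro conjI exI[where x = "\<lambda>k. 2 ^ k"] exI[where x = p] exI[where x = c] f_meas J allI p
        step_lim lim[unfolded S_def])
  then show ?thesis
    by blast
qed

section \<open>Gaussian tail bounds\<close>

lemma Phi_bar_eq_measure: "Phi_bar y = measure std_normal_distribution {y<..}"
proof -
  interpret real_distribution std_normal_distribution
    by (rule real_dist_normal_dist)
  have "{y<..} = space std_normal_distribution - {..y}"
    by auto
  moreover have "measure std_normal_distribution (space std_normal_distribution - {..y})
      = 1 - measure std_normal_distribution {..y}"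
    by (rule prob_compl) simp
  ultimately show ?thesis
    unfolding Phi_bar_def Phi_def cdf_def by simp
qed

lemma Phi_bar_nonneg: "0 \<le> Phi_bar y"
  by (simp add: Phi_bar_eq_measure)

lemma Phi_bar_le_1: "Phi_bar y \<le> 1"
proof -
  interpret real_distribution std_normal_distribution
    by (rule real_dist_normal_dist)
  show ?thesis
    by (simp add: Phi_bar_eq_measure)
qed

lemma Phi_bar_antimono: "x \<le> y \<Longrightarrow> Phi_bar y \<le> Phi_bar x"
proof -
  interpret real_distribution std_normal_distribution
    by (rule real_dist_normal_dist)
  show "x \<le> y \<Longrightarrow> Phi_bar y \<le> Phi_bar x"
    by (auto simp: Phi_bar_eq_measure intro!: finite_measure_mono)
qed

lemma Phi_bar_measurable [measurable]: "Phi_bar \<in> borel_measurable borel"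
proof -
  have "mono (\<lambda>y. - Phi_bar y)"
    by (auto intro!: monoI Phi_bar_antimono)
  then have "(\<lambda>y. - (- Phi_bar y)) \<in> borel_measurable borel"
    by (intro borel_measurable_uminus borel_measurable_mono)
  then show ?thesis
    by simp
qed

lemma set_integrable_Phi_bar_square:
  fixes h :: "real \<Rightarrow> real"
  assumes [measurable]: "h \<in> borel_measurable borel"
  shows "set_integrable lborel {a..b} (\<lambda>z. (Phi_bar (h z))\<^sup>2)"
  unfolding set_integrable_def
proof (rule Bochner_Integration.integrable_bound)
  show "integrable lborel (indicator {a..b} :: real \<Rightarrow> real)"
    by (intro integrable_real_indicator) (auto simp: emeasure_lborel_Icc_eq)
qed (auto split: split_indicator simp: Phi_bar_nonneg Phi_bar_le_1 power_le_one)

lemma ennreal_Phi_bar: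
  "ennreal (Phi_bar y) = (\<integral>\<^sup>+s. ennreal (std_normal_density s) * indicator {y<..} s \<partial>lborel)"
proof -
  interpret real_distribution std_normal_distribution
    by (rule real_dist_normal_dist)
  show ?thesis
    by (simp add: Phi_bar_eq_measure emeasure_eq_measure[symmetric] emeasure_density)
qed

text \<open>On \<open>{y<..}\<close> the density \<open>\<phi>(s)\<close> is at most \<open>s \<phi>(s) / y\<close>, which has the primitive \<open>-\<phi>(s) / y\<close>.\<close>

lemma Phi_bar_upper_bound:
  assumes "0 < y"
  shows "Phi_bar y \<le> std_normal_density y / y"
proof -
  have lim: "((\<lambda>s::real. - std_normal_density s / y) \<longlongrightarrow> 0) at_top"
    unfolding std_normal_density_def using assms by real_asymp
  have deriv: "((\<lambda>s. - std_normal_density s / y) has_real_derivative s * std_normal_density s / y) (at s)" for s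
    unfolding std_normal_density_def using assms
    by (auto intro!: derivative_eq_intros simp: field_simps)
  have "ennreal (Phi_bar y) \<le> (\<integral>\<^sup>+s. ennreal (s * std_normal_density s / y) * indicator {y..} s \<partial>lborel)"
    unfolding ennreal_Phi_bar
  proof (intro nn_integral_mono)
    fix s :: real
    have "std_normal_density s \<le> s * std_normal_density s / y" if "y < s"
    proof -
      have "y * std_normal_density s \<le> s * std_normal_density s"
        using that by (intro mult_right_mono) auto
      then show ?thesis
        using assms by (simp add: field_simps)
    qed
    then show "ennreal (std_normal_density s) * indicator {y<..} s
        \<le> ennreal (s * std_normal_density s / y) * indicator {y..} s"
      by (auto split: split_indicator intro!: ennreal_leI)
  qed
  also have "\<dots> = ennreal (0 - (- std_normal_density y / y))"
    using assms by (intro nn_integral_FTC_atLeast lim deriv) auto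
  finally show ?thesis
    using assms by (simp add: ennreal_le_iff)
qed

text \<open>The density is at least its right endpoint value on an interval of length \<open>h\<close> to the right of \<open>y\<close>.\<close>

lemma Phi_bar_lower_bound:
  assumes "0 \<le> y" "0 \<le> h"
  shows "h * std_normal_density (y + h) \<le> Phi_bar y"
proof -
  have "ennreal (h * std_normal_density (y + h))
      = (\<integral>\<^sup>+s. ennreal (std_normal_density (y + h)) * indicator {y<..y + h} s \<partial>lborel)"
    using assms by (simp add: nn_integral_cmult_indicator ennreal_mult mult.commute)
  also have "\<dots> \<le> ennreal (Phi_bar y)"
    unfolding ennreal_Phi_bar
  proof (intro nn_integral_mono)
    fix s :: real
    have "std_normal_density (y + h) \<le> std_normal_density s" if "y < s" "s \<le> y + h"
      using that assms power_mono[of s "y + h" 2] by (simp add: std_normal_density_def divide_right_mono)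
    then show "ennreal (std_normal_density (y + h)) * indicator {y<..y + h} s
        \<le> ennreal (std_normal_density s) * indicator {y<..} s"
      by (auto split: split_indicator intro!: ennreal_leI)
  qed
  finally show ?thesis
    by (simp add: ennreal_le_iff Phi_bar_nonneg)
qed

section \<open>Variance of the conga line\<close>

lemma brownian_motion_reversed_increment:
  assumes "brownian_motion M W" "0 \<le> s" "s < u" "u \<le> t"
  shows "distributed M lborel (\<lambda>\<omega>. reversed W t u \<omega> - reversed W t s \<omega>) (normal_density 0 (sqrt (u - s)))"
proof -
  interpret brownian_motion M W
    by (rule assms)
  have "distributed M lborel (\<lambda>\<omega>. W (t - s) \<omega> - W (t - u) \<omega>) (normal_density 0 (sqrt (t - s - (t - u))))"
    using assms by (intro W_normal) auto
  then show ?thesis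
    by (simp add: reversed_def)
qed

lemma (in prob_space) centered_normal_square_integrable:
  assumes D: "distributed M lborel Y (normal_density 0 \<sigma>)" and "0 < \<sigma>"
  shows "integrable M (\<lambda>\<omega>. (Y \<omega>)\<^sup>2)" "expectation (\<lambda>\<omega>. (Y \<omega>)\<^sup>2) = \<sigma>\<^sup>2"
proof -
  show "integrable M (\<lambda>\<omega>. (Y \<omega>)\<^sup>2)"
    using integrable_normal_moment[of \<sigma> 0 2] \<open>0 < \<sigma>\<close>
    by (subst distributed_integrable[OF D, symmetric]) auto
  show "expectation (\<lambda>\<omega>. (Y \<omega>)\<^sup>2) = \<sigma>\<^sup>2"
    using normal_distributed_variance[OF \<open>0 < \<sigma>\<close> D] normal_distributed_expectation[OF \<open>0 < \<sigma>\<close> D] by simp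
qed

lemma isometric_increments_reversed:
  assumes "brownian_motion M W"
  shows "isometric_increments M (reversed W t) 0 t"
proof -
  interpret brownian_motion M W
    by (rule assms)
  have *: "(\<lambda>\<omega>. reversed W t u \<omega> - reversed W t s \<omega>) \<in> borel_measurable M \<and>
      integrable M (\<lambda>\<omega>. (reversed W t u \<omega> - reversed W t s \<omega>)\<^sup>2) \<and>
      expectation (\<lambda>\<omega>. (reversed W t u \<omega> - reversed W t s \<omega>)\<^sup>2) = u - s"
    if "0 \<le> s" "s \<le> u" "u \<le> t" for s u
  proof (cases "s = u")
    case False
    then have D: "distributed M lborel (\<lambda>\<omega>. reversed W t u \<omega> - reversed W t s \<omega>) (normal_density 0 (sqrt (u - s)))"
      using that by (intro brownian_motion_reversed_increment[OF assms]) auto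
    show ?thesis
      using distributed_measurable[OF D] centered_normal_square_integrable[OF D] False that by simp
  qed simp
  show ?thesis
    by standard (use * in blast)+
qed

lemma reversed_increment_expectation:
  assumes "brownian_motion M W" "0 \<le> s" "s \<le> u" "u \<le> t"
  shows "(\<integral>\<omega>. reversed W t u \<omega> - reversed W t s \<omega> \<partial>M) = 0"
proof (cases "s = u")
  case False
  interpret brownian_motion M W
    by (rule assms)
  show ?thesis
    using normal_distributed_expectation[OF _ brownian_motion_reversed_increment[OF assms(1), of s u t]]
      False assms by simp
qed simp

text \<open>The argument of \<open>Phi_bar\<close> is \<open>x / (\<sigma> sqrt z) - (\<alpha> / \<sigma>) sqrt z\<close>, a nonincreasing function of \<open>z\<close>. The value
  \<open>0\<close> at the origin keeps the function monotone there.\<close>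

lemma Phi_bar_conga_mono_on:
  fixes x \<alpha> \<sigma> t :: real
  assumes "0 \<le> x" "0 \<le> \<alpha>" "0 < \<sigma>"
  shows "mono_on {0..t} (\<lambda>z. if z = 0 then 0 else Phi_bar ((x - \<alpha> * z) / (\<sigma> * sqrt z)))"
proof (rule mono_onI)
  fix z w assume zw: "z \<in> {0..t}" "w \<in> {0..t}" "z \<le> w"
  show "(if z = 0 then 0 else Phi_bar ((x - \<alpha> * z) / (\<sigma> * sqrt z)))
      \<le> (if w = 0 then 0 else Phi_bar ((x - \<alpha> * w) / (\<sigma> * sqrt w)))"
  proof (cases "z = 0")
    case False
    have split: "(x - \<alpha> * y) / (\<sigma> * sqrt y) = x / (\<sigma> * sqrt y) - \<alpha> / \<sigma> * sqrt y" if "0 < y" for y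
    proof -
      have "\<alpha> * y / (\<sigma> * sqrt y) = \<alpha> / \<sigma> * (y / sqrt y)"
        by simp
      then show ?thesis
        using that by (simp only: diff_divide_distrib real_div_sqrt less_imp_le)
    qed
    have "x / (\<sigma> * sqrt w) - \<alpha> / \<sigma> * sqrt w \<le> x / (\<sigma> * sqrt z) - \<alpha> / \<sigma> * sqrt z"
      using False assms zw by (intro diff_mono divide_left_mono mult_left_mono mult_pos_pos) auto
    then show ?thesis
      using False zw by (auto simp: split intro!: Phi_bar_antimono)
  qed (simp add: Phi_bar_nonneg)
qed

lemma variance_conga:
  assumes W: "brownian_motion M W" and "0 < \<alpha>" "\<alpha> < 1" "0 \<le> x" "0 \<le> t"
  shows "prob_space.variance M (conga M W \<alpha> x t)
      = (LINT z:{0..t}|lborel. (Phi_bar ((x - \<alpha> * z) / (conga_sigma \<alpha> * sqrt z)))\<^sup>2)"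
proof -
  interpret brownian_motion M W
    by (rule W)
  define f where "f z = Phi_bar ((x - \<alpha> * z) / (conga_sigma \<alpha> * sqrt z))" for z
  have "0 < conga_sigma \<alpha>"
    using assms by (simp add: conga_sigma_def)
  note iso = isometric_increments_reversed[OF W, of t]
  have f_borel: "f \<in> borel_measurable lborel"
    unfolding f_def[abs_def] by measurable
  \<comment> \<open>The existence theorem needs the value \<open>0\<close> at the origin; the modification is undone afterwards.\<close>
  have "\<exists>J. has_wiener_integral M (reversed W t) (\<lambda>z. if z = 0 then 0 else f z) 0 t J"
    unfolding f_def using assms \<open>0 < conga_sigma \<alpha>\<close>
    by (intro has_wiener_integral_mono_on_exists[OF iso] Phi_bar_conga_mono_on) auto
  then obtain J where "has_wiener_integral M (reversed W t) (\<lambda>z. if z = 0 then 0 else f z) 0 t J"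
    by blast
  then have "has_wiener_integral M (reversed W t) f 0 t J"
    by (rule has_wiener_integral_cong) (use f_borel in \<open>auto simp: set_borel_measurable_def\<close>)
  then have conga: "has_wiener_integral M (reversed W t) f 0 t (conga M W \<alpha> x t)"
    unfolding conga_def f_def[symmetric] wiener_integral_def
    by (rule someI[where P = "has_wiener_integral M (reversed W t) f 0 t" and x = J])
  have "set_integrable lborel {0..t} (\<lambda>z. (f z)\<^sup>2)"
    unfolding f_def by (intro set_integrable_Phi_bar_square) measurable
  then have "expectation (\<lambda>\<omega>. (conga M W \<alpha> x t \<omega>)\<^sup>2) = (LINT z:{0..t}|lborel. (f z)\<^sup>2)"
    by (rule has_wiener_integral_second_moment[OF iso conga])
  moreover have "expectation (conga M W \<alpha> x t) = 0"
    using reversed_increment_expectation[OF W]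
    by (intro has_wiener_integral_expectation[OF iso _ conga]) auto
  ultimately show ?thesis
    by (simp add: f_def)
qed

section \<open>Order of magnitude of the variance integral\<close>

text \<open>The order of the variance at position \<open>\<alpha> t + \<sigma> sqrt t L\<close>: the squared Gaussian tail
  \<open>exp (- L\<^sup>2) / L\<^sup>2\<close> times the width \<open>sqrt t / L\<close> of the window that contributes.\<close>

definition profile :: "real \<Rightarrow> real \<Rightarrow> real" where
  "profile t L = sqrt t * exp (- L\<^sup>2) / L ^ 3"

text \<open>Replacing \<open>sqrt z\<close> by \<open>sqrt t\<close> in the denominator makes the argument smaller and affine in \<open>t - z\<close>.\<close>

lemma conga_argument_ge:
  fixes \<alpha> \<sigma> t z L :: real
  assumes "0 < \<alpha>" "0 < \<sigma>" "0 \<le> L" "0 < z" "z \<le> t"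
  shows "L + \<alpha> / \<sigma> * ((t - z) / sqrt t) \<le> (\<alpha> * t + \<sigma> * (sqrt t * L) - \<alpha> * z) / (\<sigma> * sqrt z)"
proof -
  have "L + \<alpha> / \<sigma> * ((t - z) / sqrt t) = (\<alpha> * t + \<sigma> * (sqrt t * L) - \<alpha> * z) / (\<sigma> * sqrt t)"
    using assms by (simp add: field_simps)
  also have "\<dots> \<le> (\<alpha> * t + \<sigma> * (sqrt t * L) - \<alpha> * z) / (\<sigma> * sqrt z)"
    using assms by (intro divide_left_mono mult_left_mono mult_pos_pos) (auto simp: mult_left_mono add_increasing2 diff_ge_0_iff_ge)
  finally show ?thesis .
qed

text \<open>With \<open>v\<close> a lower bound for the excess of the argument over \<open>L\<close>, Mills' bound and \<open>(L + v)\<^sup>2 \<ge> L\<^sup>2 + 2 L v\<close> dominate the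
  integrand by an exponential in \<open>t - z\<close> whose decay rate \<open>c\<close> is of order \<open>L / sqrt t\<close>.\<close>

lemma integral_Phi_bar_square_le:
  fixes \<alpha> \<sigma> t L :: real
  assumes "0 < \<alpha>" "0 < \<sigma>" "0 < L" "0 < t"
  shows "(LINT z:{0..t}|lborel. (Phi_bar ((\<alpha> * t + \<sigma> * (sqrt t * L) - \<alpha> * z) / (\<sigma> * sqrt z)))\<^sup>2)
      \<le> \<sigma> / (4 * pi * \<alpha>) * profile t L"
proof -
  define \<kappa> where "\<kappa> = \<alpha> / \<sigma>"
  define c where "c = 2 * L * \<kappa> / sqrt t"
  define K where "K = exp (- L\<^sup>2) / (2 * pi * L\<^sup>2)"
  let ?f = "\<lambda>z. (Phi_bar ((\<alpha> * t + \<sigma> * (sqrt t * L) - \<alpha> * z) / (\<sigma> * sqrt z)))\<^sup>2"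
  have pos: "0 < \<kappa>" "0 < c" "0 < K"
    using assms by (auto simp: \<kappa>_def c_def K_def)
  have bound: "?f z \<le> K * exp (- c * (t - z))" if "0 < z" "z \<le> t" for z
  proof -
    define v where "v = \<kappa> * ((t - z) / sqrt t)"
    have v: "0 \<le> v"
      using pos that by (simp add: v_def)
    have "Phi_bar ((\<alpha> * t + \<sigma> * (sqrt t * L) - \<alpha> * z) / (\<sigma> * sqrt z)) \<le> Phi_bar (L + v)"
      unfolding v_def \<kappa>_def using assms that by (intro Phi_bar_antimono conga_argument_ge) auto
    also have "\<dots> \<le> std_normal_density (L + v) / (L + v)"
      using assms v by (intro Phi_bar_upper_bound) auto
    also have "\<dots> \<le> std_normal_density (L + v) / L"
      using assms v by (intro divide_left_mono mult_pos_pos) auto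
    finally have "?f z \<le> (std_normal_density (L + v) / L)\<^sup>2"
      by (intro power_mono Phi_bar_nonneg)
    also have "\<dots> = exp (- (L + v)\<^sup>2) / (2 * pi * L\<^sup>2)"
      by (simp add: std_normal_density_def power_divide power_mult_distrib exp_double[symmetric])
    also have "\<dots> \<le> exp (- L\<^sup>2 + - c * (t - z)) / (2 * pi * L\<^sup>2)"
    proof (intro divide_right_mono iffD2[OF exp_le_cancel_iff])
      have "c * (t - z) = 2 * L * v"
        by (simp add: c_def v_def)
      then show "- (L + v)\<^sup>2 \<le> - L\<^sup>2 + - c * (t - z)"
        by (simp add: power2_sum)
    qed (use assms in auto)
    also have "\<dots> = K * exp (- c * (t - z))"
      unfolding exp_add K_def by simp
    finally show ?thesis .
  qed
  have bochner: "has_bochner_integral lborel (\<lambda>z. K * exp (- c * (t - z)) * indicator {0..t} z)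
      (K / c * exp (- c * (t - t)) - K / c * exp (- c * (t - 0)))"
    using assms pos
    by (intro has_bochner_integral_FTC_Icc_real[where F = "\<lambda>z. K / c * exp (- c * (t - z))"])
       (auto intro!: derivative_eq_intros)
  have "(LINT z:{0..t}|lborel. ?f z) \<le> (\<integral>z. K * exp (- c * (t - z)) * indicator {0..t} z \<partial>lborel)"
    unfolding set_lebesgue_integral_def
  proof (rule integral_mono_AE')
    show "integrable lborel (\<lambda>z. K * exp (- c * (t - z)) * indicator {0..t} z)"
      using bochner by (rule integrable.intros)
    show "AE z in lborel. indicator {0..t} z *\<^sub>R ?f z \<le> K * exp (- c * (t - z)) * indicator {0..t} z"
      using AE_lborel_singleton[of 0]
    proof eventually_elim
      case (elim z)
      then show ?case
        using bound[of z] by (auto split: split_indicator)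
    qed
    show "AE z in lborel. 0 \<le> K * exp (- c * (t - z)) * indicator {0..t} z"
      using pos by auto
  qed
  also have "\<dots> = K / c - K / c * exp (- c * t)"
    using has_bochner_integral_integral_eq[OF bochner] by simp
  also have "\<dots> \<le> K / c"
    using pos by simp
  also have "\<dots> = \<sigma> / (4 * pi * \<alpha>) * profile t L"
    using assms by (simp add: K_def c_def \<kappa>_def profile_def field_simps power2_eq_square power3_eq_cube)
  finally show ?thesis .
qed

text \<open>Throughout the window \<open>{t - sqrt t / L..t}\<close> the argument exceeds \<open>L\<close> by a multiple of \<open>1 / L\<close> only,
  which changes the Gaussian tail by no more than a constant factor.\<close>

lemma conga_argument_le:
  fixes \<alpha> \<sigma> t z L :: real
  assumes "0 < \<alpha>" "0 < \<sigma>" "1 \<le> L" "L \<le> sqrt t" "4 \<le> t" and z: "t - sqrt t / L \<le> z" "z \<le> t"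
  shows "(\<alpha> * t + \<sigma> * (sqrt t * L) - \<alpha> * z) / (\<sigma> * sqrt z) \<le> L + (2 * (\<alpha> / \<sigma>) + 1) / L"
proof -
  define \<kappa> where "\<kappa> = \<alpha> / \<sigma>"
  define s where "s = sqrt t"
  define u where "u = 1 / (s * L)"
  have \<kappa>: "0 < \<kappa>"
    using assms by (simp add: \<kappa>_def)
  have s: "2 \<le> s" "t = s\<^sup>2" "L \<le> s"
    using assms real_le_rsqrt[of 2 t] by (auto simp: s_def)
  have sL: "2 \<le> s * L"
    using mult_mono[of 2 s 1 L] s assms by simp
  have u: "0 < u" "u \<le> 1 / 2"
    using sL by (auto simp: u_def field_simps)
  have ut: "u * t = s / L"
    using s assms by (simp add: u_def power2_eq_square)
  have "(1 - u) * t \<le> z"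
    using z ut by (simp add: s_def algebra_simps)
  \<comment> \<open>This is the estimate \<open>1 / sqrt (1 - u) \<le> 1 + u\<close> for \<open>u \<le> 1 / 2\<close>, squared and cleared of denominators.\<close>
  moreover have "1 \<le> (1 + u)\<^sup>2 * (1 - u)"
  proof -
    have "0 \<le> u * (1 - u - u * u)"
      using u mult_mono[of u "1/2" u "1/2"] by (intro mult_nonneg_nonneg) auto
    then show ?thesis
      by (simp add: power2_eq_square algebra_simps)
  qed
  ultimately have "t \<le> (1 + u)\<^sup>2 * z"
  proof -
    assume a: "(1 - u) * t \<le> z" and b: "1 \<le> (1 + u)\<^sup>2 * (1 - u)"
    have "1 * t \<le> (1 + u)\<^sup>2 * (1 - u) * t"
      using b assms by (intro mult_right_mono) auto
    also have "\<dots> \<le> (1 + u)\<^sup>2 * z"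
      using mult_left_mono[OF a, of "(1 + u)\<^sup>2"] by (simp add: mult.assoc)
    finally show ?thesis
      by simp
  qed
  then have "s \<le> sqrt ((1 + u)\<^sup>2 * z)"
    unfolding s_def by (rule real_sqrt_le_mono)
  then have sz: "s \<le> (1 + u) * sqrt z"
    using u by (simp add: real_sqrt_mult)
  have z_pos: "0 < z"
  proof -
    have "0 < (1 - u) * t"
      using u assms by simp
    then show ?thesis
      using \<open>(1 - u) * t \<le> z\<close> by linarith
  qed
  have "(\<alpha> * t + \<sigma> * (sqrt t * L) - \<alpha> * z) / (\<sigma> * sqrt z) = (\<kappa> * (t - z) + s * L) / sqrt z"
    using assms z_pos by (simp add: \<kappa>_def s_def field_simps)
  also have "\<dots> \<le> (\<kappa> * (s / L) + s * L) / sqrt z"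
    using \<kappa> z z_pos by (intro divide_right_mono add_right_mono mult_left_mono) (auto simp: s_def)
  also have "\<dots> = (\<kappa> / L + L) * (s / sqrt z)"
    by (simp add: field_simps)
  also have "\<dots> \<le> (\<kappa> / L + L) * (1 + u)"
    using sz z_pos \<kappa> assms by (intro mult_left_mono) (auto simp: field_simps)
  also have "\<dots> = L + \<kappa> / L + \<kappa> / L * u + 1 / s"
    using assms s by (simp add: u_def field_simps)
  also have "\<dots> \<le> L + \<kappa> / L + \<kappa> / L * 1 + 1 / L"
    using assms s u \<kappa> by (intro add_mono order_refl mult_left_mono divide_left_mono) auto
  also have "\<dots> = L + (2 * (\<alpha> / \<sigma>) + 1) / L"
    by (simp add: \<kappa>_def add_divide_distrib)
  finally show ?thesis .
qed

text \<open>On the window the integrand is bounded below by the constant \<open>K\<close> of order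
  \<open>exp (- L\<^sup>2) / L\<^sup>2\<close>: the tail at \<open>L + (B - 1) / L\<close> is at least \<open>1 / L\<close> times the density at \<open>L + B / L\<close>,
  and \<open>(L + B / L)\<^sup>2\<close> differs from \<open>L\<^sup>2\<close> by a bounded amount.\<close>

lemma integral_Phi_bar_square_ge:
  fixes \<alpha> \<sigma> t L :: real
  assumes "0 < \<alpha>" "0 < \<sigma>" "1 \<le> L" "L \<le> sqrt t" "4 \<le> t"
  shows "exp (- (2 * (2 * (\<alpha> / \<sigma>) + 2) + (2 * (\<alpha> / \<sigma>) + 2)\<^sup>2)) / (2 * pi) * profile t L
      \<le> (LINT z:{0..t}|lborel. (Phi_bar ((\<alpha> * t + \<sigma> * (sqrt t * L) - \<alpha> * z) / (\<sigma> * sqrt z)))\<^sup>2)"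
proof -
  define B where "B = 2 * (\<alpha> / \<sigma>) + 2"
  define K where "K = exp (- (L\<^sup>2 + 2 * B + B\<^sup>2)) / (2 * pi * L\<^sup>2)"
  let ?f = "\<lambda>z. (Phi_bar ((\<alpha> * t + \<sigma> * (sqrt t * L) - \<alpha> * z) / (\<sigma> * sqrt z)))\<^sup>2"
  have B: "0 < B"
    using assms by (simp add: B_def add_pos_pos)
  have window: "0 \<le> t - sqrt t / L"
  proof -
    have "sqrt t / L \<le> sqrt t / 1"
      using assms by (intro divide_left_mono) auto
    also have "\<dots> \<le> sqrt t * sqrt t"
      using assms mult_left_mono[of 1 "sqrt t" "sqrt t"] by simp
    finally show ?thesis
      using assms by simp
  qed
  have K: "K \<le> ?f z" if z: "t - sqrt t / L \<le> z" "z \<le> t" for z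
  proof -
    have "K \<le> exp (- (L + B / L)\<^sup>2) / (2 * pi * L\<^sup>2)"
      unfolding K_def
    proof (intro divide_right_mono iffD2[OF exp_le_cancel_iff])
      have "(B / L)\<^sup>2 \<le> (B / 1)\<^sup>2"
        using B assms by (intro power_mono divide_left_mono) auto
      then show "- (L\<^sup>2 + 2 * B + B\<^sup>2) \<le> - (L + B / L)\<^sup>2"
        using assms by (simp add: power2_sum)
    qed (use assms in auto)
    also have "\<dots> = (1 / L * std_normal_density (L + B / L))\<^sup>2"
      by (simp add: std_normal_density_def power_divide power_mult_distrib exp_double[symmetric])
    also have "\<dots> \<le> (Phi_bar (L + (B - 1) / L))\<^sup>2"
    proof (rule power_mono)
      have "1 / L * std_normal_density (L + (B - 1) / L + 1 / L) \<le> Phi_bar (L + (B - 1) / L)"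
        using assms by (intro Phi_bar_lower_bound) (auto simp: B_def)
      moreover have "L + (B - 1) / L + 1 / L = L + B / L"
        by (simp add: diff_divide_distrib)
      ultimately show "1 / L * std_normal_density (L + B / L) \<le> Phi_bar (L + (B - 1) / L)"
        by simp
    qed (use assms in auto)
    also have "\<dots> \<le> ?f z"
    proof (intro power_mono Phi_bar_antimono Phi_bar_nonneg)
      have "B - 1 = 2 * (\<alpha> / \<sigma>) + 1"
        by (simp add: B_def)
      then show "(\<alpha> * t + \<sigma> * (sqrt t * L) - \<alpha> * z) / (\<sigma> * sqrt z) \<le> L + (B - 1) / L"
        using conga_argument_le[OF assms z] by (simp only:)
    qed
    finally show ?thesis .
  qed
  have "exp (- (2 * B + B\<^sup>2)) / (2 * pi) * profile t L = K * (sqrt t / L)"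
    unfolding K_def profile_def minus_add_distrib exp_add
    by (simp add: power2_eq_square power3_eq_cube ac_simps)
  also have "\<dots> = (\<integral>z. indicator {t - sqrt t / L..t} z * K \<partial>lborel)"
    using assms by simp
  also have "\<dots> \<le> (LINT z:{0..t}|lborel. ?f z)"
    unfolding set_lebesgue_integral_def
  proof (rule integral_mono)
    show "integrable lborel (\<lambda>z. indicator {t - sqrt t / L..t} z * K)"
      by (intro integrable_mult_left integrable_real_indicator) (auto simp: emeasure_lborel_Icc_eq)
    show "integrable lborel (\<lambda>z. indicator {0..t} z *\<^sub>R ?f z)"
      unfolding set_integrable_def[symmetric] by (intro set_integrable_Phi_bar_square) measurable
    show "indicator {t - sqrt t / L..t} z * K \<le> indicator {0..t} z *\<^sub>R ?f z" for z
      using K[of z] window by (auto split: split_indicator)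
  qed
  finally show ?thesis
    unfolding B_def .
qed

section \<open>Asymptotics along the three curves\<close>

lemma profile_eq_powr:
  assumes "0 < t" "0 < q"
  shows "profile t (sqrt q) = sqrt t * exp (- q) / q powr (3 / 2)"
proof -
  have "sqrt q ^ 3 = (q powr (1 / 2)) powr 3"
    using assms by (simp add: powr_half_sqrt)
  also have "\<dots> = q powr (3 / 2)"
    by (simp add: powr_powr)
  finally show ?thesis
    using assms by (simp add: profile_def)
qed

lemma eventually_profile_eq_powr:
  assumes "filterlim q at_top at_top"
  shows "\<forall>\<^sub>F t in at_top. sqrt t * exp (- q t) / q t powr (3 / 2) = profile t (sqrt (q t))"
proof -
  have "\<forall>\<^sub>F t in at_top. 0 < q t"
    using assms by (simp add: filterlim_at_top_dense)
  with eventually_gt_at_top[of 0] show ?thesis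
    by eventually_elim (simp add: profile_eq_powr)
qed

lemma scaled_ln_filterlim_at_top:
  assumes "0 < lam"
  shows "filterlim (\<lambda>t::real. lam * ln t) at_top at_top"
  using assms by real_asymp

lemma profile_tendsto_0:
  assumes "1 / 2 \<le> lam"
  shows "((\<lambda>t. profile t (sqrt (lam * ln t))) \<longlongrightarrow> 0) at_top"
proof -
  have "((\<lambda>t::real. sqrt t * exp (- (lam * ln t)) / (lam * ln t) powr (3 / 2)) \<longlongrightarrow> 0) at_top"
  proof (cases "lam = 1 / 2")
    case True
    have "((\<lambda>t::real. sqrt t * exp (- (1 / 2 * ln t)) / (1 / 2 * ln t) powr (3 / 2)) \<longlongrightarrow> 0) at_top"
      by real_asymp
    then show ?thesis
      by (simp only: True)
  next
    case False
    then have "1 / 2 < lam"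
      using assms by simp
    then show ?thesis
      by real_asymp
  qed
  moreover have "filterlim (\<lambda>t::real. lam * ln t) at_top at_top"
    using assms by (intro scaled_ln_filterlim_at_top) simp
  ultimately show ?thesis
    by (rule Lim_transform_eventually[OF _ eventually_profile_eq_powr])
qed

lemma profile_filterlim_at_top:
  assumes "0 < lam" "lam < 1 / 2"
  shows "filterlim (\<lambda>t. profile t (sqrt (lam * ln t))) at_top at_top"
proof -
  have "filterlim (\<lambda>t::real. sqrt t * exp (- (lam * ln t)) / (lam * ln t) powr (3 / 2)) at_top at_top"
    using assms by real_asymp
  then show ?thesis
    using eventually_profile_eq_powr[OF scaled_ln_filterlim_at_top[OF assms(1)]]
    by (simp cong: filterlim_cong)
qed

text \<open>The curve is chosen so that \<open>sqrt t * exp (- q t) = \<delta> * (ln t) powr (3/2)\<close>, which the factor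
  \<open>(q t) powr (3/2)\<close> in the denominator balances.\<close>

lemma profile_critical_tendsto:
  assumes "0 < \<delta>"
  shows "((\<lambda>t. profile t (sqrt (1 / 2 * ln t - 3 / 2 * ln (ln t) - ln \<delta>))) \<longlongrightarrow> \<delta> * 2 powr (3 / 2)) at_top"
proof -
  define q where "q t = 1 / 2 * ln t - 3 / 2 * ln (ln t) - ln \<delta>" for t :: real
  have q: "filterlim q at_top at_top"
    unfolding q_def[abs_def] by real_asymp
  have "((\<lambda>t. ln t / q t) \<longlongrightarrow> 2) at_top"
    unfolding q_def by real_asymp
  then have "((\<lambda>t. \<delta> * (ln t / q t) powr (3 / 2)) \<longlongrightarrow> \<delta> * 2 powr (3 / 2)) at_top"
    by (intro tendsto_intros) auto
  moreover have "\<forall>\<^sub>F t in at_top. \<delta> * (ln t / q t) powr (3 / 2) = profile t (sqrt (q t))"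
  proof -
    have "\<forall>\<^sub>F t in at_top. 0 < q t"
      using q by (simp add: filterlim_at_top_dense)
    with eventually_gt_at_top[of 1] show ?thesis
    proof eventually_elim
      case (elim t)
      then have pos: "0 < ln t" "0 < t"
        by auto
      have "sqrt t * exp (- q t) = exp (1 / 2 * ln t + - q t)"
        unfolding exp_add using pos by (simp add: powr_half_sqrt[symmetric] powr_def)
      also have "\<dots> = exp (3 / 2 * ln (ln t) + ln \<delta>)"
        by (simp add: q_def)
      also have "\<dots> = \<delta> * ln t powr (3 / 2)"
        using assms pos by (simp add: exp_add powr_def)
      finally show ?case
        using pos elim by (simp add: profile_eq_powr powr_divide)
    qed
  qed
  ultimately show ?thesis
    unfolding q_def by (rule Lim_transform_eventually)
qed

lemma variance_conga_bounds:
  assumes W: "brownian_motion M W" and \<alpha>: "0 < \<alpha>" "\<alpha> < 1"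
    and q: "filterlim q at_top at_top" "\<forall>\<^sub>F t in at_top. q t \<le> t"
  shows "\<exists>c C. 0 < c \<and> 0 < C \<and> (\<forall>\<^sub>F t in at_top.
      c * profile t (sqrt (q t))
        \<le> prob_space.variance M (conga M W \<alpha> (\<alpha> * t + conga_sigma \<alpha> * sqrt (t * q t)) t) \<and>
      prob_space.variance M (conga M W \<alpha> (\<alpha> * t + conga_sigma \<alpha> * sqrt (t * q t)) t)
        \<le> C * profile t (sqrt (q t)))"
proof (intro exI conjI)
  define \<sigma> where "\<sigma> = conga_sigma \<alpha>"
  have \<sigma>: "0 < \<sigma>"
    using \<alpha> by (simp add: \<sigma>_def conga_sigma_def)
  show "0 < exp (- (2 * (2 * (\<alpha> / \<sigma>) + 2) + (2 * (\<alpha> / \<sigma>) + 2)\<^sup>2)) / (2 * pi)" "0 < \<sigma> / (4 * pi * \<alpha>)"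
    using \<alpha> \<sigma> by simp_all
  have "\<forall>\<^sub>F t in at_top. 1 \<le> q t"
    using q(1) by (simp add: filterlim_at_top)
  with q(2) eventually_ge_at_top[of 4] show "\<forall>\<^sub>F t in at_top.
        exp (- (2 * (2 * (\<alpha> / \<sigma>) + 2) + (2 * (\<alpha> / \<sigma>) + 2)\<^sup>2)) / (2 * pi) * profile t (sqrt (q t))
          \<le> prob_space.variance M (conga M W \<alpha> (\<alpha> * t + conga_sigma \<alpha> * sqrt (t * q t)) t) \<and>
        prob_space.variance M (conga M W \<alpha> (\<alpha> * t + conga_sigma \<alpha> * sqrt (t * q t)) t)
          \<le> \<sigma> / (4 * pi * \<alpha>) * profile t (sqrt (q t))"
  proof eventually_elim
    case (elim t)
    have "prob_space.variance M (conga M W \<alpha> (\<alpha> * t + conga_sigma \<alpha> * sqrt (t * q t)) t)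
        = (LINT z:{0..t}|lborel. (Phi_bar ((\<alpha> * t + \<sigma> * (sqrt t * sqrt (q t)) - \<alpha> * z) / (\<sigma> * sqrt z)))\<^sup>2)"
      using elim \<alpha> \<sigma> variance_conga[OF W \<alpha>, of "\<alpha> * t + \<sigma> * sqrt (t * q t)" t]
      by (simp add: \<sigma>_def[symmetric] real_sqrt_mult)
    then show ?case
      using integral_Phi_bar_square_ge[OF \<alpha>(1) \<sigma>, of "sqrt (q t)" t]
        integral_Phi_bar_square_le[OF \<alpha>(1) \<sigma>, of "sqrt (q t)" t] elim
      by simp
  qed
qed

theorem corollary3p1:
  fixes M :: "'a measure" and W :: "real \<Rightarrow> 'a \<Rightarrow> real" and \<alpha> lam :: real
  assumes "0 < \<alpha>" and "\<alpha> < 1"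
    and "brownian_motion M W"
    and "0 < lam"
  shows
    "(1 / 2 \<le> lam \<longrightarrow>
        ((\<lambda>t. prob_space.variance M
            (conga M W \<alpha> (\<alpha> * t + conga_sigma \<alpha> * sqrt (lam * t * ln t)) t)) \<longlongrightarrow> 0) at_top) \<and>
     (lam < 1 / 2 \<longrightarrow>
        filterlim (\<lambda>t. prob_space.variance M
            (conga M W \<alpha> (\<alpha> * t + conga_sigma \<alpha> * sqrt (lam * t * ln t)) t)) at_top at_top) \<and>
     (\<forall>\<delta>>0. same_order
        (\<lambda>t. prob_space.variance M
            (conga M W \<alpha>
              (\<alpha> * t + conga_sigma \<alpha> *
                 sqrt (t * (1 / 2 * ln t - 3 / 2 * ln (ln t) - ln \<delta>))) t))
        (\<lambda>_. \<delta>))"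
proof -
  define V where "V q t = prob_space.variance M
      (conga M W \<alpha> (\<alpha> * t + conga_sigma \<alpha> * sqrt (t * q t)) t)" for q :: "real \<Rightarrow> real" and t
  have bounds: "\<exists>c C. 0 < c \<and> 0 < C \<and>
      (\<forall>\<^sub>F t in at_top. c * profile t (sqrt (q t)) \<le> V q t \<and> V q t \<le> C * profile t (sqrt (q t)))"
    if "filterlim q at_top at_top" "\<forall>\<^sub>F t in at_top. q t \<le> t" for q
    unfolding V_def by (rule variance_conga_bounds[OF assms(3,1,2) that])
  have "\<forall>\<^sub>F t in at_top. lam * ln t \<le> t"
    by real_asymp
  from bounds[OF scaled_ln_filterlim_at_top[OF \<open>0 < lam\<close>] this]
  obtain c C where c: "0 < c"
    and log_bounds: "\<forall>\<^sub>F t in at_top. c * profile t (sqrt (lam * ln t)) \<le> V (\<lambda>t. lam * ln t) t \<and>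
      V (\<lambda>t. lam * ln t) t \<le> C * profile t (sqrt (lam * ln t))"
    by blast
  have V_log: "V (\<lambda>t. lam * ln t) t = prob_space.variance M
      (conga M W \<alpha> (\<alpha> * t + conga_sigma \<alpha> * sqrt (lam * t * ln t)) t)" for t
    by (simp add: V_def ac_simps)
  have "(V (\<lambda>t. lam * ln t) \<longlongrightarrow> 0) at_top" if "1 / 2 \<le> lam"
  proof (rule tendsto_sandwich)
    show "((\<lambda>t. c * profile t (sqrt (lam * ln t))) \<longlongrightarrow> 0) at_top"
      "((\<lambda>t. C * profile t (sqrt (lam * ln t))) \<longlongrightarrow> 0) at_top"
      by (intro tendsto_mult_right_zero profile_tendsto_0 that)+
  qed (use log_bounds in \<open>auto elim: eventually_mono\<close>)
  moreover have "filterlim (V (\<lambda>t. lam * ln t)) at_top at_top" if "lam < 1 / 2"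
  proof (rule filterlim_at_top_mono)
    show "filterlim (\<lambda>t. c * profile t (sqrt (lam * ln t))) at_top at_top"
      using c by (intro filterlim_tendsto_pos_mult_at_top[OF tendsto_const] profile_filterlim_at_top assms that)
  qed (use log_bounds in \<open>auto elim: eventually_mono\<close>)
  moreover have "same_order (V (\<lambda>t. 1 / 2 * ln t - 3 / 2 * ln (ln t) - ln \<delta>)) (\<lambda>_. \<delta>)" if "0 < \<delta>" for \<delta>
  proof -
    define q where "q t = 1 / 2 * ln t - 3 / 2 * ln (ln t) - ln \<delta>" for t :: real
    define l where "l = \<delta> * 2 powr (3 / 2)"
    have l: "0 < l"
      using that by (simp add: l_def)
    have "filterlim q at_top at_top" "\<forall>\<^sub>F t in at_top. q t \<le> t"
      unfolding q_def[abs_def] by real_asymp+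
    from bounds[OF this] obtain c C where c: "0 < c" "0 < C"
      and V_bounds: "\<forall>\<^sub>F t in at_top. c * profile t (sqrt (q t)) \<le> V q t \<and> V q t \<le> C * profile t (sqrt (q t))"
      by blast
    have lim: "((\<lambda>t. profile t (sqrt (q t))) \<longlongrightarrow> l) at_top"
      unfolding q_def l_def by (rule profile_critical_tendsto[OF that])
    have "\<forall>\<^sub>F t in at_top. l / 2 < profile t (sqrt (q t))" "\<forall>\<^sub>F t in at_top. profile t (sqrt (q t)) < 2 * l"
      using order_tendstoD(1)[OF lim, of "l / 2"] order_tendstoD(2)[OF lim, of "2 * l"] l by simp_all
    with V_bounds have "\<forall>\<^sub>F t in at_top. 0 < V q t \<and> 0 < \<delta> \<and>
        max (V q t / \<delta>) (\<delta> / V q t) \<le> max (C * (2 * l) / \<delta>) (\<delta> / (c * (l / 2)))"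
    proof eventually_elim
      case (elim t)
      have "c * (l / 2) < c * profile t (sqrt (q t))" "C * profile t (sqrt (q t)) < C * (2 * l)"
        using elim c by auto
      then have V: "c * (l / 2) \<le> V q t" "V q t \<le> C * (2 * l)"
        using elim by auto
      have pos: "0 < c * (l / 2)"
        using c l by simp
      with V(1) have V_pos: "0 < V q t"
        by linarith
      have "V q t / \<delta> \<le> C * (2 * l) / \<delta>"
        using V(2) that by (intro divide_right_mono) simp_all
      moreover have "\<delta> / V q t \<le> \<delta> / (c * (l / 2))"
        using that by (intro divide_left_mono mult_pos_pos V(1) V_pos pos) simp
      ultimately show ?case
        using that V_pos by (simp only: max.mono simp_thms)
    qed
    then show ?thesis
      unfolding same_order_def q_def[abs_def] by blast
  qed
  ultimately show ?thesis
    unfolding V_log[abs_def, symmetric] unfolding V_def by blast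
qed

end
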